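(* Let $T=[t_{ij}]\in\mathbb{R}^{n\times n}$ be the transition matrix of an $n$-state ergodic homogeneous Markov chain with states $1,\ldots,n$, and let $\Gamma$ be the weighted digraph without loops whose vertices are $1,\ldots,n$ and whose arc weights are equal to the corresponding transition probabilities in $T$. Then Kemeny's constant of the chain is equal to $$1+\frac{\sigma_{n-2}}{\sigma_{n-1}},$$ where $\sigma_k$ is the total weight of in-forests of $\Gamma$ with $k$ arcs.
   Context: The Markov chain $(X_p)_{p\ge 0}$ is ergodic in the sense that its transition matrix $T$ is an irreducible stochastic matrix. Let $\boldsymbol\pi=(\pi_1,\ldots,\pi_n)$ be the normalized left Perron vector of $T$, i.e. the row vector with $\boldsymbol\pi T=\boldsymbol\pi$, nonnegative entries, and $\sum_{i=1}^n\pi_i=1$. The hitting time from $i$ to $j$ is $\widehat m_{ij}=\mathrm{E}(F_{ij})=\sum_{k=1}^\infty k\Pr(F_{ij}=k)$ with $F_{ij}=\min\{p>0: X_p=j\mid X_0=i\}$ (note $p>0$). Kemeny's constant is $\sum_{j=1}^n\pi_j\,\widehat m_{ij}$, whose value does not depend on the state $i$; thus the claim is that this sum equals the stated value for every $i\in\{1,\ldots,n\}$. The digraph $\Gamma$ has vertex set $\{1,\ldots,n\}$ and has an arc $(i,j)$ with $i\neq j$ whenever $t_{ij}\ne 0$; the weight of this arc is $t_{ij}$. There are no loops. A converging tree is a weakly connected digraph in which one vertex, called the root, has outdegree zero and all the remaining vertices have outdegree one. An in-forest of $\Gamma$ is a spanning subdigraph of $\Gamma$ (i.e. containing all vertices)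 all of whose weak components are converging trees. The weight of a weighted digraph is the product of its arc weights (equal to $1$ if it has no arcs); the total weight of a set of digraphs is the sum of the weights of its members ($0$ for the empty set). *)

theory Defs
  imports "HOL-Probability.Probability" "Graph_Theory.Graph_Theory"
begin

definition stochastic_matrix :: "real ^ 'n ^ 'n \<Rightarrow> bool" where
  "stochastic_matrix T \<longleftrightarrow> (\<forall>i j. 0 \<le> T $ i $ j) \<and> (\<forall>i. (\<Sum>j\<in>UNIV. T $ i $ j) = 1)"

definition irreducible_matrix :: "real ^ 'n ^ 'n \<Rightarrow> bool" where
  "irreducible_matrix T \<longleftrightarrow> (\<forall>i j. (i, j) \<in> {(k, l). T $ k $ l \<noteq> 0}\<^sup>+)"

definition normalized_left_perron_vector :: "real ^ 'n ^ 'n \<Rightarrow> real ^ 'n \<Rightarrow> bool" where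
  "normalized_left_perron_vector T \<pi> \<longleftrightarrow>
     \<pi> v* T = \<pi> \<and> (\<forall>i. 0 \<le> \<pi> $ i) \<and> (\<Sum>i\<in>UNIV. \<pi> $ i) = 1"

text \<open>The initial distribution is arbitrary.\<close>

definition markov_chain :: "'w measure \<Rightarrow> (nat \<Rightarrow> 'w \<Rightarrow> 'n) \<Rightarrow> real ^ 'n ^ 'n \<Rightarrow> bool" where
  "markov_chain M X T \<longleftrightarrow>
     prob_space M \<and>
     (\<forall>p. X p \<in> measurable M (count_space UNIV)) \<and>
     (\<forall>p x j. \<P>(\<omega> in M. \<forall>q\<le>p. X q \<omega> = x q) > 0 \<longrightarrow>
        \<P>(\<omega> in M. X (Suc p) \<omega> = j \<bar> \<forall>q\<le>p. X q \<omega> = x q) = T $ x p $ j)"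

text \<open>Only strictly positive times count; the value is \<open>\<infinity>\<close> if the state is never hit.\<close>

definition hitting_time :: "(nat \<Rightarrow> 'w \<Rightarrow> 'n) \<Rightarrow> 'n \<Rightarrow> 'w \<Rightarrow> enat" where
  "hitting_time X j \<omega> = Inf {enat p | p. p > 0 \<and> X p \<omega> = j}"

text \<open>
  Taken in \<^typ>\<open>ennreal\<close>, so that a divergent series has the value \<open>\<infinity>\<close>. The summand for
  \<open>k = 0\<close> vanishes. The conditioning is meaningful only if \<open>X 0\<close> takes the value \<open>i\<close> with
  positive probability.
\<close>

definition mean_hitting_time :: "'w measure \<Rightarrow> (nat \<Rightarrow> 'w \<Rightarrow> 'n) \<Rightarrow> 'n \<Rightarrow> 'n \<Rightarrow> ennreal" where
  "mean_hitting_time M X i j =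
     (\<Sum>k. of_nat k * ennreal \<P>(\<omega> in M. hitting_time X j \<omega> = enat k \<bar> X 0 \<omega> = i))"

definition kemeny_constant ::
  "'w measure \<Rightarrow> (nat \<Rightarrow> 'w \<Rightarrow> 'n :: finite) \<Rightarrow> real ^ 'n \<Rightarrow> 'n \<Rightarrow> ennreal" where
  "kemeny_constant M X \<pi> i = (\<Sum>j\<in>UNIV. ennreal (\<pi> $ j) * mean_hitting_time M X i j)"

definition transition_digraph :: "real ^ 'n ^ 'n \<Rightarrow> ('n, 'n \<times> 'n) pre_digraph" where
  "transition_digraph T =
     with_proj \<lparr>pverts = UNIV, parcs = {(i, j). i \<noteq> j \<and> T $ i $ j \<noteq> 0}\<rparr>"

definition arc_weight :: "real ^ 'n ^ 'n \<Rightarrow> 'n \<times> 'n \<Rightarrow> real" where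
  "arc_weight T = (\<lambda>(i, j). T $ i $ j)"

text \<open>
  \<^const>\<open>Digraph_Component.connected\<close> is weak connectivity (and implies that there is a vertex);
  the short name would refer to topological connectedness.
\<close>

definition weak_component :: "('a, 'b) pre_digraph \<Rightarrow> ('a, 'b) pre_digraph \<Rightarrow> bool" where
  "weak_component C G \<longleftrightarrow> pre_digraph.max_subgraph G Digraph_Component.connected C"

definition converging_tree :: "('a, 'b) pre_digraph \<Rightarrow> bool" where
  "converging_tree G \<longleftrightarrow>
     Digraph_Component.connected G \<and>
     (\<exists>r \<in> verts G. out_degree G r = 0 \<and> (\<forall>v \<in> verts G - {r}. out_degree G v = 1))"

definition in_forest :: "('a, 'b) pre_digraph \<Rightarrow> ('a, 'b) pre_digraph \<Rightarrow> bool" where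
  "in_forest F G \<longleftrightarrow> spanning F G \<and> (\<forall>C. weak_component C F \<longrightarrow> converging_tree C)"

definition digraph_weight :: "('b \<Rightarrow> real) \<Rightarrow> ('a, 'b) pre_digraph \<Rightarrow> real" where
  "digraph_weight w H = (\<Prod>e\<in>arcs H. w e)"

text \<open>
  The number of arcs is an integer, so that for a one-state chain the index \<open>n - 2 = -1\<close>
  gives the empty sum.
\<close>

definition in_forest_weight :: "real ^ 'n ^ 'n \<Rightarrow> int \<Rightarrow> real" where
  "in_forest_weight T k =
     (\<Sum>F | in_forest F (transition_digraph T) \<and> int (card (arcs F)) = k.
        digraph_weight (arc_weight T) F)"

end

theory Submission
  imports Defs
begin

text \<open>
  Let \<open>q\<^sub>j\<close> be the total weight of the spanning in-trees with root \<open>j\<close>, and \<open>h\<^sub>j i\<close> that of the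
  in-forests with two trees, one rooted at \<open>j\<close> and the other containing \<open>i\<close>. Every in-forest in
  which \<open>i\<close> is not a root arises uniquely from one in which \<open>i\<close> is an additional root, by adding an
  arc from \<open>i\<close> to a vertex of another tree. This gives \<open>h\<^sub>j i = q\<^sub>j + (\<Sum>k\<noteq>j. t\<^sub>i\<^sub>k h\<^sub>j k)\<close> for \<open>i \<noteq> j\<close> and
  \<open>\<sigma>\<^sub>n\<^sub>-\<^sub>1 = q\<^sub>j + (\<Sum>k\<noteq>j. t\<^sub>j\<^sub>k h\<^sub>j k)\<close>, which up to the factor \<open>q\<^sub>j\<close> is the first-step equation for the
  mean hitting times of \<open>j\<close>; hence these are \<open>h\<^sub>j i / q\<^sub>j\<close> for \<open>i \<noteq> j\<close> and \<open>\<sigma>\<^sub>n\<^sub>-\<^sub>1 / q\<^sub>j\<close> for \<open>i = j\<close>.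
  Stationarity of \<open>\<pi>\<close> yields \<open>\<pi>\<^sub>j = q\<^sub>j / \<sigma>\<^sub>n\<^sub>-\<^sub>1\<close>, so Kemeny's constant is \<open>1 + (\<Sum>j\<noteq>i. h\<^sub>j i) / \<sigma>\<^sub>n\<^sub>-\<^sub>1\<close>. In an
  in-forest with two trees exactly one root \<open>j\<close> has \<open>i\<close> in the other tree, so the sum is \<open>\<sigma>\<^sub>n\<^sub>-\<^sub>2\<close>.
\<close>

section \<open>In-forests as maps\<close>

text \<open>An in-forest with root set \<open>S\<close> is encoded by its successor map, which fixes the roots.\<close>


definition forest_maps :: "'n set \<Rightarrow> ('n \<Rightarrow> 'n) set" where
  "forest_maps S = {f. (\<forall>s\<in>S. f s = s) \<and> (\<forall>v. \<exists>m. (f ^^ m) v \<in> S)}"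

text \<open>An orbit that meets a fixed point stays there, so at most one \<open>r\<close>
  qualifies; for \<open>f\<close> in \<open>forest_maps S\<close> one exists, the root of the tree
  containing \<open>v\<close>.\<close>

definition forest_root :: "('n \<Rightarrow> 'n) \<Rightarrow> 'n \<Rightarrow> 'n" where
  "forest_root f v = (THE r. f r = r \<and> (\<exists>m. (f ^^ m) v = r))"

text \<open>Roots carry no arc. A map using a zero entry of \<open>T\<close> outside
  \<open>S\<close> gets weight 0, so sums may range over all of
  \<open>forest_maps S\<close>.\<close>

definition map_weight :: "real ^ 'n ^ 'n \<Rightarrow> 'n set \<Rightarrow> ('n \<Rightarrow> 'n) \<Rightarrow> real" where
  "map_weight T S f = (\<Prod>v\<in>-S. T $ v $ f v)"

section \<open>Iterates and roots of a successor map\<close>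

lemma funpow_fixed: "f r = r \<Longrightarrow> (f ^^ m) r = r"
  by (induction m) auto

lemma funpow_fixed_mono:
  assumes "f r = r" "(f ^^ m) v = r" "m \<le> k"
  shows "(f ^^ k) v = r"
proof -
  have "(f ^^ k) v = (f ^^ (k - m)) ((f ^^ m) v)"
    using assms(3) by (metis add.commute comp_apply funpow_add le_add_diff_inverse)
  then show ?thesis using assms funpow_fixed by metis
qed

lemma forest_root_eqI:
  assumes "f r = r" "(f ^^ m) v = r"
  shows "forest_root f v = r"
  unfolding forest_root_def
proof (rule the_equality)
  show "f r = r \<and> (\<exists>m. (f ^^ m) v = r)" using assms by auto
  fix s assume "f s = s \<and> (\<exists>m. (f ^^ m) v = s)"
  then obtain k where k: "f s = s" "(f ^^ k) v = s" by auto
  show "s = r"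
    using funpow_fixed_mono[OF assms, of "max m k"] funpow_fixed_mono[OF k, of "max m k"] by simp
qed

lemma forest_maps_fixed: "f \<in> forest_maps S \<Longrightarrow> s \<in> S \<Longrightarrow> f s = s"
  by (simp add: forest_maps_def)

lemma forest_maps_root:
  assumes "f \<in> forest_maps S"
  obtains m where "(f ^^ m) v = forest_root f v" "forest_root f v \<in> S" "f (forest_root f v) = forest_root f v"
proof -
  obtain m where m: "(f ^^ m) v \<in> S" using assms by (auto simp: forest_maps_def)
  then have "f ((f ^^ m) v) = (f ^^ m) v" using assms by (simp add: forest_maps_fixed)
  then have "forest_root f v = (f ^^ m) v" by (rule forest_root_eqI) simp
  with m assms that show ?thesis by (metis forest_maps_fixed)
qed

lemma forest_root_in: "f \<in> forest_maps S \<Longrightarrow> forest_root f v \<in> S"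
  by (rule forest_maps_root)

lemma forest_root_fixed: "f r = r \<Longrightarrow> forest_root f r = r"
  by (rule forest_root_eqI[where m = 0]) auto

lemma forest_root_step:
  assumes "f \<in> forest_maps S"
  shows "forest_root f (f v) = forest_root f v"
proof -
  obtain m where m: "(f ^^ m) v = forest_root f v" "f (forest_root f v) = forest_root f v"
    by (rule forest_maps_root[OF assms])
  have "(f ^^ m) (f v) = f ((f ^^ m) v)" by (metis comp_apply funpow_Suc_right funpow.simps(2))
  with m show ?thesis by (intro forest_root_eqI) auto
qed

lemma forest_maps_fixed_iff:
  assumes "f \<in> forest_maps S"
  shows "f v = v \<longleftrightarrow> v \<in> S"
proof
  assume "f v = v"
  obtain m where "(f ^^ m) v \<in> S" using assms by (auto simp: forest_maps_def)
  then show "v \<in> S" using funpow_fixed[of f v m] \<open>f v = v\<close> by simp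
qed (simp add: forest_maps_fixed[OF assms])

section \<open>Grafting a tree onto another and cutting it off\<close>

text \<open>The path from \<open>l\<close> to its root avoids \<open>i\<close>, so the new arc
  closes no cycle. The whole tree of \<open>i\<close> is grafted onto the tree of \<open>l\<close>,
  and only its vertices change their root.\<close>

lemma forest_maps_add_arc:
  assumes g: "g \<in> forest_maps (insert i S)" and i: "i \<notin> S" and l: "forest_root g l \<noteq> i"
  shows "g(i := l) \<in> forest_maps S"
    and "forest_root (g(i := l)) v = (if forest_root g v = i then forest_root g l else forest_root g v)"
proof -
  let ?f = "g(i := l)"
  have gi: "g i = i" using g by (simp add: forest_maps_fixed)
  have fix_f: "?f s = s" if "s \<in> S" for s
    using that i g by (auto simp: forest_maps_def)
  \<comment> \<open>Outside the tree of \<open>i\<close> no orbit of \<open>g\<close> meets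
    \<open>i\<close>, the only vertex where the two maps differ.\<close>
  have off: "(?f ^^ m) v = (g ^^ m) v" if v: "forest_root g v \<noteq> i" for m v
  proof (induction m)
    case (Suc m)
    have "(g ^^ m) v \<noteq> i" using v forest_root_eqI[where f = g, OF gi] by blast
    then show ?case using Suc by simp
  qed simp
  \<comment> \<open>From the tree of \<open>i\<close> the path runs to \<open>i\<close>, jumps to
    \<open>l\<close> and continues as under \<open>g\<close>. As \<open>m\<close> need not be
    minimal and \<open>g\<close> rests at \<open>i\<close>, the case \<open>v = i\<close> also
    occurs in the induction step.\<close>
  have rl: "\<exists>m. (?f ^^ m) v = forest_root g l" if "(g ^^ m) v = i" for m v
    using that
  proof (induction m arbitrary: v)
    case 0
    obtain p where "(g ^^ p) l = forest_root g l" by (rule forest_maps_root[OF g])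
    then have "(?f ^^ Suc p) v = forest_root g l" using off[OF l] 0 by (simp add: funpow_Suc_right del: funpow.simps(2))
    then show ?case by blast
  next
    case (Suc m)
    show ?case
    proof (cases "v = i")
      case True
      obtain p where "(g ^^ p) l = forest_root g l" by (rule forest_maps_root[OF g])
      then have "(?f ^^ Suc p) v = forest_root g l" using off[OF l] True by (simp add: funpow_Suc_right del: funpow.simps(2))
      then show ?thesis by blast
    next
      case False
      have "(g ^^ m) (g v) = i" using Suc.prems by (simp add: funpow_Suc_right del: funpow.simps(2))
      then obtain p where "(?f ^^ p) (g v) = forest_root g l" using Suc.IH by blast
      then have "(?f ^^ Suc p) v = forest_root g l" using False by (simp add: funpow_Suc_right del: funpow.simps(2))
      then show ?thesis by blast
    qed
  qed
  have r_in: "(if forest_root g v = i then forest_root g l else forest_root g v) \<in> S" for v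
    using forest_root_in[OF g] l by (metis insertE)
  have reach: "\<exists>m. (?f ^^ m) v = (if forest_root g v = i then forest_root g l else forest_root g v)" for v
  proof (cases "forest_root g v = i")
    case True
    then show ?thesis using rl forest_maps_root[OF g, of v] by metis
  next
    case False
    then show ?thesis using off forest_maps_root[OF g, of v] by metis
  qed
  show "?f \<in> forest_maps S"
  proof -
    have "\<exists>m. (?f ^^ m) v \<in> S" for v
      using reach[of v] r_in[of v] by metis
    then show ?thesis using fix_f unfolding forest_maps_def by blast
  qed
  show "forest_root ?f v = (if forest_root g v = i then forest_root g l else forest_root g v)"
  proof -
    obtain m where "(?f ^^ m) v = (if forest_root g v = i then forest_root g l else forest_root g v)"
      using reach by blast
    with fix_f[OF r_in] show ?thesis by (rule forest_root_eqI)
  qed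
qed

text \<open>Inverse of grafting: cutting the arc out of \<open>i\<close> makes \<open>i\<close> a
  root, and the former target \<open>f i\<close> lies in another tree because \<open>i\<close> would
  otherwise lie on a cycle of \<open>f\<close>.\<close>

lemma forest_maps_remove_arc:
  assumes f: "f \<in> forest_maps S" and i: "i \<notin> S"
  shows "f(i := i) \<in> forest_maps (insert i S)" and "forest_root (f(i := i)) (f i) \<noteq> i"
proof -
  let ?g = "f(i := i)"
  have reach: "\<exists>k. (?g ^^ k) v \<in> insert i S" if "(f ^^ m) v \<in> S" for m v
    using that
  proof (induction m arbitrary: v)
    case 0
    then show ?case by (intro exI[of _ 0]) simp
  next
    case (Suc m)
    show ?case
    proof (cases "v = i")
      case True
      then show ?thesis by (intro exI[of _ 0]) simp
    next
      case False
      have "(f ^^ m) (f v) \<in> S" using Suc.prems by (simp add: funpow_Suc_right del: funpow.simps(2))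
      then obtain k where "(?g ^^ k) (f v) \<in> insert i S" using Suc.IH by blast
      then have "(?g ^^ Suc k) v \<in> insert i S" using False by (simp add: funpow_Suc_right del: funpow.simps(2))
      then show ?thesis by blast
    qed
  qed
  show g: "?g \<in> forest_maps (insert i S)"
  proof -
    have "\<exists>k. (?g ^^ k) v \<in> insert i S" for v
      using f reach unfolding forest_maps_def by blast
    moreover have "\<forall>s\<in>insert i S. ?g s = s" using f by (simp add: forest_maps_def)
    ultimately show ?thesis unfolding forest_maps_def by blast
  qed
  \<comment> \<open>Up to its first visit to \<open>i\<close>, an orbit of \<open>?g\<close> is also
    an orbit of \<open>f\<close>.\<close>
  have returns: "\<exists>m. (f ^^ m) v = i" if "(?g ^^ k) v = i" for k v
    using that
  proof (induction k arbitrary: v)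
    case 0
    then show ?case by (intro exI[of _ 0]) simp
  next
    case (Suc k)
    show ?case
    proof (cases "v = i")
      case True
      then show ?thesis by (intro exI[of _ 0]) simp
    next
      case False
      have "?g v = f v" using False by simp
      moreover have "(?g ^^ k) (?g v) = i"
        using Suc.prems by (simp only: funpow_Suc_right comp_apply)
      ultimately have "(?g ^^ k) (f v) = i" by (simp only:)
      then obtain m where "(f ^^ m) (f v) = i" using Suc.IH by blast
      then have "(f ^^ Suc m) v = i" by (simp add: funpow_Suc_right del: funpow.simps(2))
      then show ?thesis by blast
    qed
  qed
  show "forest_root ?g (f i) \<noteq> i"
  proof
    assume "forest_root ?g (f i) = i"
    then obtain m where m: "(f ^^ m) (f i) = i" using returns forest_maps_root[OF g] by metis
    have "forest_root f i \<in> S" using f by (rule forest_root_in)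
    obtain p where p: "(f ^^ p) i = forest_root f i" "f (forest_root f i) = forest_root f i" by (rule forest_maps_root[OF f])
    have per: "(f ^^ Suc m) i = i" using m by (simp add: funpow_Suc_right del: funpow.simps(2))
    \<comment> \<open>Running through the supposed cycle \<open>p\<close> times takes at least
      \<open>p\<close> steps, by which time the orbit rests at its root; then \<open>i\<close> would
      be that root, hence in \<open>S\<close>.\<close>
    have "((f ^^ Suc m) ^^ p) i = i" using per by (rule funpow_fixed)
    then have "(f ^^ (Suc m * p)) i = i" by (simp add: funpow_mult del: funpow.simps(2) mult_Suc)
    moreover have "(f ^^ (Suc m * p)) i = forest_root f i"
      using p(2,1) by (rule funpow_fixed_mono) simp
    ultimately show False using \<open>forest_root f i \<in> S\<close> i by simp
  qed
qed

lemma map_weight_add_arc: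
  fixes T :: "real ^ 'n ^ ('n :: finite)"
  assumes "i \<notin> S"
  shows "map_weight T S (g(i := l)) = map_weight T (insert i S) g * T $ i $ l"
proof -
  have "- S = insert i (- insert i S)" using assms by auto
  then have "map_weight T S (g(i := l)) = (\<Prod>v\<in>insert i (- insert i S). T $ v $ (g(i := l)) v)"
    by (simp add: map_weight_def)
  also have "\<dots> = T $ i $ l * (\<Prod>v\<in>- insert i S. T $ v $ (g(i := l)) v)"
    by (subst prod.insert) auto
  also have "(\<Prod>v\<in>- insert i S. T $ v $ (g(i := l)) v) = map_weight T (insert i S) g"
    unfolding map_weight_def by (intro prod.cong) auto
  finally show ?thesis by (simp only: mult.commute)
qed

lemma finite_forest_maps [simp]: "finite (forest_maps S :: ('n :: finite \<Rightarrow> 'n) set)"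
  by (rule finite_subset[OF subset_UNIV]) simp

text \<open>Grafting and cutting form a bijection between the maps \<open>f\<close> and the pairs
  \<open>(g, l)\<close> with \<open>l\<close> outside the tree of \<open>i\<close>. The factor
  \<open>\<phi>\<close> is left free for root indicators and partial row sums.\<close>

lemma sum_forest_maps_split:
  fixes T :: "real ^ 'n ^ ('n :: finite)"
  assumes i: "i \<notin> S"
  shows "(\<Sum>f\<in>forest_maps S. map_weight T S f * \<phi> f) =
         (\<Sum>g\<in>forest_maps (insert i S). map_weight T (insert i S) g *
            (\<Sum>l | forest_root g l \<noteq> i. T $ i $ l * \<phi> (g(i := l))))"
proof -
  have "(\<Sum>f\<in>forest_maps S. map_weight T S f * \<phi> f) =
    (\<Sum>(g, l)\<in>(SIGMA g:forest_maps (insert i S). {l. forest_root g l \<noteq> i}).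
       map_weight T S (g(i := l)) * \<phi> (g(i := l)))"
  proof (rule sum.reindex_bij_witness[where i = "\<lambda>(g, l). g(i := l)" and j = "\<lambda>f. (f(i := i), f i)"],
      goal_cases)
    case (1 f) then show ?case by simp
  next
    case (2 f) then show ?case using forest_maps_remove_arc[OF _ i] by simp
  next
    case (3 p) then show ?case by (auto simp: forest_maps_def)
  next
    case (4 p) then show ?case using forest_maps_add_arc(1)[OF _ i] by auto
  next
    case (5 f) then show ?case by simp
  qed
  also have "\<dots> = (\<Sum>g\<in>forest_maps (insert i S). \<Sum>l | forest_root g l \<noteq> i.
       map_weight T S (g(i := l)) * \<phi> (g(i := l)))"
    by (subst sum.Sigma) auto
  also have "\<dots> = (\<Sum>g\<in>forest_maps (insert i S). map_weight T (insert i S) g *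
            (\<Sum>l | forest_root g l \<noteq> i. T $ i $ l * \<phi> (g(i := l))))"
    by (intro sum.cong refl) (simp add: map_weight_add_arc[OF i] sum_distrib_left mult.assoc)
  finally show ?thesis .
qed


section \<open>Weights of trees and of forests with two trees\<close>

definition tree_sum :: "real ^ 'n ^ 'n \<Rightarrow> 'n \<Rightarrow> real" where
  "tree_sum T j = (\<Sum>f\<in>forest_maps {j}. map_weight T {j} f)"

text \<open>This is \<open>h\<^sub>j v\<close> of the overview, with \<open>r\<close> as the second
  root; for \<open>v \<noteq> j\<close> it will be \<open>tree_sum T j\<close> times the mean
  hitting time of \<open>j\<close> from \<open>v\<close>.\<close>

definition hit_sum :: "real ^ 'n ^ 'n \<Rightarrow> 'n \<Rightarrow> ('n :: finite) \<Rightarrow> real" where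
  "hit_sum T j v = (\<Sum>r\<in>-{j}. \<Sum>f\<in>forest_maps {j, r}. map_weight T {j, r} f * of_bool (forest_root f v = r))"

lemma forest_root_self: "f \<in> forest_maps S \<Longrightarrow> s \<in> S \<Longrightarrow> forest_root f s = s"
  by (simp add: forest_maps_fixed forest_root_fixed)

lemma hit_sum_self [simp]: "hit_sum T j j = 0"
  unfolding hit_sum_def by (auto intro!: sum.neutral simp: forest_root_self)

text \<open>Interchanging the sums leaves, for each forest, the probability of stepping from
  \<open>i\<close> into the tree of the second root.\<close>

lemma sum_hit_sum:
  fixes T :: "real ^ 'n ^ ('n :: finite)"
  shows "(\<Sum>k\<in>UNIV. T $ i $ k * hit_sum T j k) =
    (\<Sum>r\<in>-{j}. \<Sum>f\<in>forest_maps {j, r}. map_weight T {j, r} f * (\<Sum>k | forest_root f k = r. T $ i $ k))"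
proof -
  have "(\<Sum>k\<in>UNIV. T $ i $ k * hit_sum T j k) =
    (\<Sum>k\<in>UNIV. \<Sum>r\<in>-{j}. \<Sum>f\<in>forest_maps {j, r}. map_weight T {j, r} f * (T $ i $ k * of_bool (forest_root f k = r)))"
    unfolding hit_sum_def by (simp only: sum_distrib_left mult_ac)
  also have "\<dots> = (\<Sum>r\<in>-{j}. \<Sum>k\<in>UNIV. \<Sum>f\<in>forest_maps {j, r}. map_weight T {j, r} f * (T $ i $ k * of_bool (forest_root f k = r)))"
    by (rule sum.swap)
  also have "\<dots> = (\<Sum>r\<in>-{j}. \<Sum>f\<in>forest_maps {j, r}. \<Sum>k\<in>UNIV. map_weight T {j, r} f * (T $ i $ k * of_bool (forest_root f k = r)))"
    by (intro sum.cong refl sum.swap)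
  also have "\<dots> = (\<Sum>r\<in>-{j}. \<Sum>f\<in>forest_maps {j, r}. map_weight T {j, r} f * (\<Sum>k | forest_root f k = r. T $ i $ k))"
    by (intro sum.cong refl) (simp add: sum_distrib_left[symmetric] of_bool_def if_distrib sum.If_cases cong: if_cong)
  finally show ?thesis .
qed

text \<open>Both sides are compared root by root: the second root \<open>r = i\<close> produces the
  term \<open>tree_sum T j\<close>, while every other \<open>r\<close> contributes equally to both
  sides.\<close>

lemma hit_sum_step:
  fixes T :: "real ^ 'n ^ ('n :: finite)"
  assumes T: "stochastic_matrix T" and ij: "i \<noteq> j"
  shows "hit_sum T j i = tree_sum T j + (\<Sum>k\<in>UNIV. T $ i $ k * hit_sum T j k)"
proof -
  \<comment> \<open>\<open>a g r\<close> is the probability of stepping from \<open>i\<close> into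
    the tree of \<open>r\<close>; \<open>H r\<close> and \<open>K r\<close> are the shares of the
    second root \<open>r\<close> in the two sides.\<close>
  define a where "a g r = (\<Sum>k | forest_root g k = r. T $ i $ k)" for g r
  define H where "H r = (\<Sum>f\<in>forest_maps {j, r}. map_weight T {j, r} f * of_bool (forest_root f i = r))" for r
  define K where "K r = (\<Sum>f\<in>forest_maps {j, r}. map_weight T {j, r} f * a f r)" for r
  have row: "(\<Sum>l | forest_root g l \<noteq> i. T $ i $ l) = 1 - a g i" for g
  proof -
    have "(\<Sum>l\<in>UNIV. T $ i $ l) = a g i + (\<Sum>l | forest_root g l \<noteq> i. T $ i $ l)"
      unfolding a_def by (subst sum.union_disjoint[symmetric]) (auto intro!: sum.cong)
    then show ?thesis using T by (simp add: stochastic_matrix_def)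
  qed
  \<comment> \<open>A tree rooted at \<open>j\<close> is a forest with roots \<open>i\<close>,
    \<open>j\<close> plus an arc by which \<open>i\<close> leaves its own tree; the arcs available
    have total weight \<open>1 - a g i\<close>.\<close>
  have Hi: "H i = tree_sum T j + K i"
  proof -
    have "tree_sum T j = (\<Sum>f\<in>forest_maps {j}. map_weight T {j} f * 1)"
      by (simp add: tree_sum_def)
    also have "\<dots> = (\<Sum>g\<in>forest_maps {i, j}. map_weight T {i, j} g * (1 - a g i))"
      using ij by (subst sum_forest_maps_split[of i]) (auto simp: row)
    also have "\<dots> = H i - K i"
      unfolding H_def K_def sum_subtractf[symmetric] insert_commute[of j i]
      by (intro sum.cong refl) (simp add: forest_root_self algebra_simps)
    finally show ?thesis by simp
  qed
  \<comment> \<open>split off the arc \<open>i \<rightarrow> l\<close> in both sums; the two sums over the forests with roots \<open>i, j, r\<close> agree termwise\<close>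
  have Hr: "H r = K r" if r: "r \<noteq> i" "r \<noteq> j" for r
  proof -
    have i: "i \<notin> {j, r}" using r ij by auto
    let ?F = "forest_maps {i, j, r}" and ?w = "map_weight T {i, j, r}"
    have "H r = (\<Sum>g\<in>?F. ?w g * (\<Sum>l | forest_root g l \<noteq> i. T $ i $ l * of_bool (forest_root (g(i := l)) i = r)))"
      unfolding H_def by (rule sum_forest_maps_split[OF i])
    also have "\<dots> = (\<Sum>g\<in>?F. ?w g * a g r)"
    proof (intro sum.cong refl arg_cong2[where f = "(*)"])
      fix g assume g: "g \<in> ?F"
      have "(\<Sum>l | forest_root g l \<noteq> i. T $ i $ l * of_bool (forest_root (g(i := l)) i = r)) =
            (\<Sum>l | forest_root g l \<noteq> i. T $ i $ l * of_bool (forest_root g l = r))"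
        using forest_maps_add_arc(2)[OF g i] g by (intro sum.cong refl) (simp add: forest_root_self)
      also have "\<dots> = a g r"
        unfolding a_def using r by (intro sum.mono_neutral_cong_right) auto
      finally show "(\<Sum>l | forest_root g l \<noteq> i. T $ i $ l * of_bool (forest_root (g(i := l)) i = r)) = a g r" .
    qed
    also have "\<dots> = (\<Sum>g\<in>?F. ?w g * (\<Sum>l | forest_root g l \<noteq> i. T $ i $ l * a (g(i := l)) r))"
    proof (intro sum.cong refl arg_cong2[where f = "(*)"])
      fix g assume g: "g \<in> ?F"
      \<comment> \<open>The tree of \<open>r\<close> grows by the tree of \<open>i\<close> exactly
        if \<open>l\<close> lies in it.\<close>
      have "a (g(i := l)) r = a g r + of_bool (forest_root g l = r) * a g i" if l: "forest_root g l \<noteq> i" for l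
      proof -
        have "a (g(i := l)) r = (\<Sum>k | (if forest_root g k = i then forest_root g l else forest_root g k) = r. T $ i $ k)"
          unfolding a_def using forest_maps_add_arc(2)[OF g i l] by simp
        also have "{k. (if forest_root g k = i then forest_root g l else forest_root g k) = r} =
           {k. forest_root g k = r} \<union> (if forest_root g l = r then {k. forest_root g k = i} else {})"
          using r by auto
        also have "(\<Sum>k\<in>\<dots>. T $ i $ k) = a g r + of_bool (forest_root g l = r) * a g i"
          unfolding a_def using r by (subst sum.union_disjoint) auto
        finally show ?thesis .
      qed
      then have "(\<Sum>l | forest_root g l \<noteq> i. T $ i $ l * a (g(i := l)) r) =
         (\<Sum>l | forest_root g l \<noteq> i. T $ i $ l * a g r + T $ i $ l * of_bool (forest_root g l = r) * a g i)"
        by (intro sum.cong refl) (simp add: algebra_simps)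
      \<comment> \<open>The remaining sum equals \<open>a g r\<close>, so the growth term makes up
        exactly for the missing \<open>a g i * a g r\<close>.\<close>
      also have "\<dots> = (1 - a g i) * a g r + (\<Sum>l | forest_root g l \<noteq> i. T $ i $ l * of_bool (forest_root g l = r)) * a g i"
        by (simp add: sum.distrib sum_distrib_right[symmetric] row)
      also have "(\<Sum>l | forest_root g l \<noteq> i. T $ i $ l * of_bool (forest_root g l = r)) = a g r"
        unfolding a_def using r by (intro sum.mono_neutral_cong_right) auto
      finally show "a g r = (\<Sum>l | forest_root g l \<noteq> i. T $ i $ l * a (g(i := l)) r)"
        by (simp add: algebra_simps del: fun_upd_apply)
    qed
    also have "\<dots> = K r"
      unfolding K_def by (rule sum_forest_maps_split[OF i, symmetric])
    finally show ?thesis .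
  qed
  have "hit_sum T j i = (\<Sum>r\<in>-{j}. H r)"
    by (simp add: hit_sum_def H_def)
  also have "\<dots> = H i + (\<Sum>r\<in>-{j} - {i}. H r)"
    using ij by (intro sum.remove) auto
  also have "\<dots> = tree_sum T j + (K i + (\<Sum>r\<in>-{j} - {i}. K r))"
    using Hi Hr by simp
  also have "K i + (\<Sum>r\<in>-{j} - {i}. K r) = (\<Sum>r\<in>-{j}. K r)"
    using ij by (intro sum.remove[symmetric]) auto
  also have "\<dots> = (\<Sum>k\<in>UNIV. T $ i $ k * hit_sum T j k)"
    by (simp add: sum_hit_sum K_def a_def)
  finally show ?thesis .
qed

text \<open>The counterpart of \<open>hit_sum_step\<close> for the return to \<open>j\<close>: a
  tree rooted at \<open>r \<noteq> j\<close> is cut at \<open>j\<close>, leaving a forest with roots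
  \<open>j\<close>, \<open>r\<close> and an arc from \<open>j\<close> into the tree of
  \<open>r\<close>.\<close>

lemma sum_tree_sum:
  fixes T :: "real ^ 'n ^ ('n :: finite)"
  shows "(\<Sum>r\<in>UNIV. tree_sum T r) = tree_sum T j + (\<Sum>k\<in>UNIV. T $ j $ k * hit_sum T j k)"
proof -
  have "tree_sum T r = (\<Sum>f\<in>forest_maps {j, r}. map_weight T {j, r} f * (\<Sum>k | forest_root f k = r. T $ j $ k))"
    if "r \<noteq> j" for r
  proof -
    have "tree_sum T r = (\<Sum>f\<in>forest_maps {r}. map_weight T {r} f * 1)"
      by (simp add: tree_sum_def)
    also have "\<dots> = (\<Sum>g\<in>forest_maps {j, r}. map_weight T {j, r} g * (\<Sum>l | forest_root g l \<noteq> j. T $ j $ l * 1))"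
      using that by (intro sum_forest_maps_split) auto
    also have "\<dots> = (\<Sum>f\<in>forest_maps {j, r}. map_weight T {j, r} f * (\<Sum>k | forest_root f k = r. T $ j $ k))"
    proof (intro sum.cong refl arg_cong2[where f = "(*)"])
      fix g assume "g \<in> forest_maps {j, r}"
      from forest_root_in[OF this] show "{l. forest_root g l \<noteq> j} = {l. forest_root g l = r}"
        using that by auto
    qed simp
    finally show ?thesis .
  qed
  then have "(\<Sum>r\<in>-{j}. tree_sum T r) = (\<Sum>k\<in>UNIV. T $ j $ k * hit_sum T j k)"
    by (simp add: sum_hit_sum)
  moreover have "(\<Sum>r\<in>UNIV. tree_sum T r) = tree_sum T j + (\<Sum>r\<in>-{j}. tree_sum T r)"
    by (simp add: sum.remove[of UNIV j] Compl_eq_Diff_UNIV)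
  ultimately show ?thesis by simp
qed

text \<open>Of the two roots of a forest exactly one has \<open>i\<close> in the other tree. Taking
  that one as the target \<open>j\<close> counts every forest once.\<close>

lemma sum_hit_sum_targets:
  fixes T :: "real ^ 'n ^ ('n :: finite)"
  shows "(\<Sum>j\<in>UNIV. hit_sum T j i) = (\<Sum>S | card S = 2. \<Sum>f\<in>forest_maps S. map_weight T S f)"
proof -
  let ?H = "\<lambda>S r. \<Sum>f\<in>forest_maps S. map_weight T S f * of_bool (forest_root f i = r)"
  have "(\<Sum>S | card S = 2. \<Sum>f\<in>forest_maps S. map_weight T S f) = (\<Sum>S | card S = 2. \<Sum>r\<in>S. ?H S r)"
  proof (intro sum.cong refl)
    fix S :: "'n set"
    have "(\<Sum>r\<in>S. ?H S r) = (\<Sum>f\<in>forest_maps S. \<Sum>r\<in>S. map_weight T S f * of_bool (forest_root f i = r))"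
      by (rule sum.swap)
    also have "\<dots> = (\<Sum>f\<in>forest_maps S. map_weight T S f)"
      by (intro sum.cong refl) (simp add: sum_distrib_left[symmetric] of_bool_def forest_root_in)
    finally show "(\<Sum>f\<in>forest_maps S. map_weight T S f) = (\<Sum>r\<in>S. ?H S r)" ..
  qed
  also have "\<dots> = (\<Sum>(S, r)\<in>(SIGMA S:{S. card S = 2}. S). ?H S r)"
    by (subst sum.Sigma) auto
  also have "\<dots> = (\<Sum>(j, r)\<in>(SIGMA j:UNIV. -{j}). ?H {j, r} r)"
  \<comment> \<open>A two-element set with a marked element \<open>r\<close> is an ordered pair of
    distinct elements; \<open>j\<close> is the unmarked one.\<close>
  proof (rule sum.reindex_bij_witness[where i = "\<lambda>(j, r). ({j, r}, r)" and j = "\<lambda>(S, r). (the_elem (S - {r}), r)"],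
      goal_cases)
    case (1 p) then show ?case by (auto simp: card_2_iff insert_commute insert_Diff_if)
  next
    case (2 p) then show ?case by (auto simp: card_2_iff insert_Diff_if)
  next
    case (3 p) then show ?case by (auto simp: insert_Diff_if)
  next
    case (4 p) then show ?case by (auto simp: card_2_iff)
  next
    case (5 p) then show ?case by (auto simp: card_2_iff insert_commute insert_Diff_if)
  qed
  also have "\<dots> = (\<Sum>j\<in>UNIV. hit_sum T j i)"
    unfolding hit_sum_def by (subst sum.Sigma) auto
  finally show ?thesis ..
qed

lemma map_weight_nonneg: "stochastic_matrix T \<Longrightarrow> 0 \<le> map_weight T S f"
  unfolding map_weight_def stochastic_matrix_def by (intro prod_nonneg) auto

lemma hit_sum_nonneg: "stochastic_matrix T \<Longrightarrow> 0 \<le> hit_sum T j v"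
  unfolding hit_sum_def by (intro sum_nonneg) (auto simp: map_weight_nonneg)

text \<open>All weights are nonnegative, so one tree of positive weight suffices; irreducibility
  supplies it.\<close>

lemma tree_sum_pos:
  fixes T :: "real ^ 'n ^ ('n :: finite)"
  assumes T: "stochastic_matrix T" "irreducible_matrix T"
  shows "0 < tree_sum T j"
proof -
  let ?E = "{(k, l). T $ k $ l \<noteq> 0}"
  \<comment> \<open>distance to \<open>j\<close>; stepping to a closer vertex defines a tree\<close>
  define d where "d v = (LEAST m. (v, j) \<in> ?E ^^ m)" for v
  have path: "(v, j) \<in> ?E ^^ d v" for v
  proof -
    have "(v, j) \<in> ?E\<^sup>*" using T(2) unfolding irreducible_matrix_def by (meson trancl_into_rtrancl)
    then obtain m where "(v, j) \<in> ?E ^^ m" using rtrancl_imp_relpow by metis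
    then show ?thesis unfolding d_def by (rule LeastI)
  qed
  have "\<exists>u. T $ v $ u \<noteq> 0 \<and> d u < d v" if "v \<noteq> j" for v
  proof -
    have "d v \<noteq> 0"
    proof
      assume "d v = 0"
      with path[of v] that show False by simp
    qed
    then obtain m where m: "d v = Suc m" using not0_implies_Suc by blast
    with path[of v] obtain u where u: "(v, u) \<in> ?E" "(u, j) \<in> ?E ^^ m"
      by (metis relpow_Suc_D2)
    then have "d u \<le> m" unfolding d_def by (intro Least_le)
    with m u show ?thesis by auto
  qed
  then obtain s where s: "T $ v $ s v \<noteq> 0" "d (s v) < d v" if "v \<noteq> j" for v by metis
  define f where "f v = (if v = j then j else s v)" for v
  have "\<exists>m. (f ^^ m) v = j" for v
  proof (induction "d v" arbitrary: v rule: less_induct)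
    case less
    show ?case
    proof (cases "v = j")
      case True
      then show ?thesis by (intro exI[of _ 0]) simp
    next
      case False
      then obtain m where "(f ^^ m) (s v) = j" using less s by blast
      then have "(f ^^ Suc m) v = j" using False by (simp add: f_def funpow_Suc_right del: funpow.simps(2))
      then show ?thesis by blast
    qed
  qed
  then have f: "f \<in> forest_maps {j}" by (simp add: forest_maps_def f_def)
  have "0 < map_weight T {j} f"
    using s(1) T(1) unfolding map_weight_def f_def stochastic_matrix_def
    by (intro prod_pos) (simp add: order_less_le)
  then show ?thesis
    unfolding tree_sum_def using f T(1)
    by (intro sum_pos2[of _ f]) (auto simp: map_weight_nonneg)
qed


section \<open>In-forests as subdigraphs\<close>

text \<open>With the projections as tail and head, a digraph is determined by its vertices and arcs;
  sub- and supergraphs inherit this form by compatibility.\<close>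

abbreviation dg :: "'a set \<Rightarrow> ('a \<times> 'a) set \<Rightarrow> ('a, 'a \<times> 'a) pre_digraph" where
  "dg V A \<equiv> with_proj \<lparr>pverts = V, parcs = A\<rparr>"

lemma dg_eqI: "tail G = fst \<Longrightarrow> head G = snd \<Longrightarrow> G = dg (verts G) (arcs G)"
  by (simp add: with_proj_def)

lemma wf_dg [simp]: "wf_digraph (dg V A) \<longleftrightarrow> A \<subseteq> V \<times> V"
  by (auto simp: wf_digraph_def)

lemma subgraph_dg [simp]:
  "subgraph (dg V A) (dg W B) \<longleftrightarrow> V \<subseteq> W \<and> A \<subseteq> B \<and> A \<subseteq> V \<times> V \<and> B \<subseteq> W \<times> W"
  by (auto simp: subgraph_def)

lemma dg_inject [simp]: "dg V A = dg W B \<longleftrightarrow> V = W \<and> A = B"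
  by (auto simp: with_proj_def)

lemma subgraph_dgE:
  assumes "subgraph H (dg W B)"
  obtains V A where "H = dg V A" "V \<subseteq> W" "A \<subseteq> B" "A \<subseteq> V \<times> V"
proof -
  have "H = dg (verts H) (arcs H)"
    using assms by (intro dg_eqI) (auto simp: subgraph_def compatible_def)
  with assms that show ?thesis by (metis subgraph_dg)
qed

lemma supgraph_dgE:
  assumes "subgraph (dg V A) H"
  obtains W B where "H = dg W B" "V \<subseteq> W" "A \<subseteq> B" "B \<subseteq> W \<times> W"
proof -
  have "H = dg (verts H) (arcs H)"
    using assms by (intro dg_eqI) (auto simp: subgraph_def compatible_def)
  with assms that show ?thesis by (metis subgraph_dg)
qed

section \<open>Weak connectivity and weak components\<close>

text \<open>Together with its converse \<open>connected_dgI\<close>, this replaces walks by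
  invariants: connectivity means that no predicate constant along arcs separates two
  vertices.\<close>

lemma connected_dgD:
  assumes conn: "Digraph_Component.connected (dg V A)"
    and P: "\<And>x y. (x, y) \<in> A \<Longrightarrow> P x \<longleftrightarrow> P y"
    and uv: "u \<in> V" "v \<in> V"
  shows "P u \<longleftrightarrow> P v"
proof -
  have "(u, v) \<in> rtrancl_on V (A\<^sup>s)"
    using conn uv by (auto simp: connected_conv)
  then show ?thesis
    by (induction rule: rtrancl_on_induct) (use P in \<open>auto simp: symcl_def\<close>)
qed

lemma connected_dgI:
  assumes u: "u \<in> V" and A: "A \<subseteq> V \<times> V"
    and inv: "\<And>P v. (\<And>x y. (x, y) \<in> A \<Longrightarrow> P x \<longleftrightarrow> P y) \<Longrightarrow> v \<in> V \<Longrightarrow> P u \<longleftrightarrow> P v"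
  shows "Digraph_Component.connected (dg V A)"
proof -
  have step: "(x, y) \<in> A\<^sup>s" "(y, x) \<in> A\<^sup>s" "x \<in> V" "y \<in> V" if "(x, y) \<in> A" for x y
    using that A by (auto simp: symcl_def image_iff)
  \<comment> \<open>The invariant used is reachability from a fixed \<open>w\<close> in the
    symmetric closure; taking \<open>v = w\<close> then shows that \<open>w\<close> reaches
    \<open>u\<close>, hence every vertex.\<close>
  have "(w, u) \<in> rtrancl_on V (A\<^sup>s) \<longleftrightarrow> (w, v) \<in> rtrancl_on V (A\<^sup>s)" if "v \<in> V" for v w
    using inv[of "\<lambda>x. (w, x) \<in> rtrancl_on V (A\<^sup>s)"] step that
    by (meson rtrancl_on_into_rtrancl_on)
  then have "(w, v) \<in> rtrancl_on V (A\<^sup>s)" if "v \<in> V" "w \<in> V" for v w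
    using that rtrancl_on_refl by metis
  then show ?thesis using u by (auto simp: connected_conv)
qed

text \<open>By maximality a component contains every arc touching it, since adding the arc and its
  ends keeps it connected.\<close>

lemma weak_component_dgE:
  assumes "weak_component C (dg UNIV A)"
  obtains V where "C = dg V {(x, y) \<in> A. x \<in> V}" "Digraph_Component.connected C"
    "\<And>x y. (x, y) \<in> A \<Longrightarrow> x \<in> V \<longleftrightarrow> y \<in> V"
proof -
  have C: "subgraph C (dg UNIV A)" "Digraph_Component.connected C"
    and max: "H \<noteq> C \<Longrightarrow> subgraph C H \<Longrightarrow> \<not> (subgraph H (dg UNIV A) \<and> Digraph_Component.connected H)" for H
    using assms by (auto simp: weak_component_def pre_digraph.max_subgraph_def)
  obtain V B where VB: "C = dg V B" "B \<subseteq> A" "B \<subseteq> V \<times> V"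
    using C(1) by (rule subgraph_dgE)
  have full: "(x, y) \<in> B" if xy: "(x, y) \<in> A" "x \<in> V \<or> y \<in> V" for x y
  proof -
    let ?V = "insert x (insert y V)" and ?B = "insert (x, y) B"
    have wf: "?B \<subseteq> ?V \<times> ?V" using VB by auto
    have "Digraph_Component.connected (dg ?V ?B)"
    proof (rule connected_dgI[of x, OF _ wf])
      fix P v assume P: "\<And>a b. (a, b) \<in> ?B \<Longrightarrow> P a \<longleftrightarrow> P b" and v: "v \<in> ?V"
      have "P x \<longleftrightarrow> P y" using P by blast
      moreover have "P a \<longleftrightarrow> P b" if "a \<in> V" "b \<in> V" for a b
        using C(2) P that unfolding VB(1) by (elim connected_dgD[where P = P]) auto
      ultimately show "P x \<longleftrightarrow> P v" using v xy(2) by auto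
    qed simp
    moreover have "subgraph C (dg ?V ?B)" "subgraph (dg ?V ?B) (dg UNIV A)"
      using VB xy by auto
    ultimately have "dg ?V ?B = C" using max by blast
    then show ?thesis unfolding VB(1) by auto
  qed
  have "B = {(x, y) \<in> A. x \<in> V}" using VB full by auto
  moreover have "x \<in> V \<longleftrightarrow> y \<in> V" if "(x, y) \<in> A" for x y
    using full[OF that] VB(3) by auto
  ultimately show ?thesis using that VB(1) C(2) by blast
qed

lemma weak_component_dg_exists:
  obtains C where "weak_component C (dg UNIV A)" "v \<in> verts C"
proof -
  \<comment> \<open>the vertices that no invariant of the arcs separates from \<open>v\<close>\<close>
  define V where "V = {w. \<forall>P. (\<forall>(x, y)\<in>A. P x = P y) \<longrightarrow> P v = (P w :: bool)}"
  let ?B = "A \<inter> V \<times> V"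
  have v: "v \<in> V" by (simp add: V_def)
  have closed: "x \<in> V \<longleftrightarrow> y \<in> V" if "(x, y) \<in> A" for x y
    using that unfolding V_def by blast
  have "Digraph_Component.connected (dg V ?B)"
  proof (rule connected_dgI[OF v])
    fix P w assume P: "\<And>x y. (x, y) \<in> ?B \<Longrightarrow> P x \<longleftrightarrow> P y" and w: "w \<in> V"
    \<comment> \<open>\<open>P\<close> is constant only along arcs inside \<open>V\<close>;
      intersecting it with \<open>V\<close>, which no arc enters or leaves, gives an invariant of
      all arcs.\<close>
    define Q where "Q x \<longleftrightarrow> x \<in> V \<and> P x" for x
    have "\<forall>(x, y)\<in>A. Q x = Q y"
      unfolding Q_def using P closed by blast
    then have "Q v = Q w" using w by (simp add: V_def)
    then show "P v \<longleftrightarrow> P w" using v w by (simp add: Q_def)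
  qed auto
  moreover have "H = dg V ?B"
    if H: "subgraph (dg V ?B) H" "subgraph H (dg UNIV A)" "Digraph_Component.connected H" for H
  proof -
    obtain W B where WB: "H = dg W B" "V \<subseteq> W" "B \<subseteq> W \<times> W"
      using H(1) by (rule supgraph_dgE)
    have BA: "B \<subseteq> A" using H(2) by (simp add: WB(1))
    have "W \<subseteq> V"
    proof
      fix w assume w: "w \<in> W"
      have "P v \<longleftrightarrow> P w" if "\<forall>(x, y)\<in>A. P x = P y" for P
        using H(3) w v BA WB(2) that unfolding WB(1) by (elim connected_dgD[where P = P]) auto
      then show "w \<in> V" by (simp add: V_def)
    qed
    then have "W = V" using WB(2) by simp
    then show ?thesis using H(1) BA WB by auto
  qed
  ultimately have "weak_component (dg V ?B) (dg UNIV A)"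
    unfolding weak_component_def pre_digraph.max_subgraph_def by auto
  with v that show ?thesis by simp
qed

section \<open>Correspondence between successor maps and in-forests\<close>

definition map_arcs :: "'n set \<Rightarrow> ('n \<Rightarrow> 'n) \<Rightarrow> ('n \<times> 'n) set" where
  "map_arcs S f = (\<lambda>v. (v, f v)) ` (- S)"

lemma in_map_arcs [simp]: "(x, y) \<in> map_arcs S f \<longleftrightarrow> x \<notin> S \<and> y = f x"
  by (auto simp: map_arcs_def)

text \<open>\<open>forest_root f\<close> is constant along arcs, hence on the component, which
  therefore contains exactly one vertex of \<open>S\<close>.\<close>

lemma converging_tree_component:
  assumes f: "f \<in> forest_maps S" and C: "weak_component C (dg UNIV (map_arcs S f))"
  shows "converging_tree C"
proof -
  obtain V where V: "C = dg V {(x, y) \<in> map_arcs S f. x \<in> V}" "Digraph_Component.connected C"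
    and closed: "\<And>x y. (x, y) \<in> map_arcs S f \<Longrightarrow> x \<in> V \<longleftrightarrow> y \<in> V"
    using C by (rule weak_component_dgE) blast
  have step: "x \<in> V \<Longrightarrow> f x \<in> V" for x
    using closed[of x "f x"] forest_maps_fixed[OF f, of x] by (cases "x \<in> S") auto
  have "V \<noteq> {}" using V(2) by (simp add: V(1) connected_conv)
  then obtain u where u: "u \<in> V" by blast
  define r where "r = forest_root f u"
  have "(f ^^ m) u \<in> V" for m by (induction m) (use u step in auto)
  then have rV: "r \<in> V" unfolding r_def using forest_maps_root[OF f, of u] by metis
  have rS: "r \<in> S" unfolding r_def by (rule forest_root_in[OF f])
  have "forest_root f v = r" if "v \<in> V" for v
  proof -
    have "forest_root f u = r \<longleftrightarrow> forest_root f v = r"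
      using V(2) u that unfolding V(1)
      by (elim connected_dgD[where P = "\<lambda>x. forest_root f x = r"]) (auto simp: forest_root_step[OF f])
    then show ?thesis by (simp add: r_def)
  qed
  then have nS: "v \<notin> S" if "v \<in> V" "v \<noteq> r" for v
    using that forest_root_self[OF f, of v] by auto
  have "out_arcs C r = {}" using rS by (auto simp: V(1) out_arcs_def)
  moreover have "out_arcs C v = {(v, f v)}" if "v \<in> V - {r}" for v
    using nS[of v] that by (auto simp: V(1) out_arcs_def)
  ultimately show ?thesis
    unfolding converging_tree_def out_degree_def using V(2) rV by (intro conjI bexI[of _ r]) (simp_all add: V(1))
qed

lemma forest_map_of_in_forest:
  fixes A :: "('n :: finite \<times> 'n) set"
  assumes tree: "\<And>C. weak_component C (dg UNIV A) \<Longrightarrow> converging_tree C"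
  obtains S f where "f \<in> forest_maps S" "A = map_arcs S f"
proof -
  \<comment> \<open>Here \<open>r\<close> is the root of the component of \<open>v\<close>. The last
    conjunct records connectivity: no arc-invariant set separates \<open>r\<close> from
    \<open>v\<close>.\<close>
  have comp: "\<exists>V r. v \<in> V \<and> r \<in> V \<and> (\<forall>y. (r, y) \<notin> A) \<and> (\<forall>x\<in>V. \<forall>y z. (x, y) \<in> A \<longrightarrow> (x, z) \<in> A \<longrightarrow> y = z) \<and>
      (\<forall>U. (\<forall>(x, y)\<in>A. x \<in> U \<longleftrightarrow> y \<in> U) \<longrightarrow> (r \<in> U \<longleftrightarrow> v \<in> U))" for v
  proof -
    obtain C where C: "weak_component C (dg UNIV A)" "v \<in> verts C"
      by (rule weak_component_dg_exists)
    obtain V where V: "C = dg V {(x, y) \<in> A. x \<in> V}" "Digraph_Component.connected C"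
      and closed: "\<And>x y. (x, y) \<in> A \<Longrightarrow> x \<in> V \<longleftrightarrow> y \<in> V"
      using C(1) by (rule weak_component_dgE) blast
    have v: "v \<in> V" using C(2) by (simp add: V(1))
    obtain r where r: "r \<in> V" "out_degree C r = 0" "\<forall>v\<in>V - {r}. out_degree C v = 1"
      using tree[OF C(1)] by (auto simp: converging_tree_def V(1))
    have r0: "(r, y) \<notin> A" for y
    proof
      assume "(r, y) \<in> A"
      with r(1) have "(r, y) \<in> out_arcs C r" by (simp add: V(1))
      moreover have "out_arcs C r = {}" using r(2) by (simp add: out_degree_def)
      ultimately show False by simp
    qed
    have "y = z" if "x \<in> V" "(x, y) \<in> A" "(x, z) \<in> A" for x y z
    proof -
      have "x \<noteq> r" using r0 that by auto
      then have "card (out_arcs C x) = 1" using r(3) that by (simp add: out_degree_def)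
      moreover have "(x, y) \<in> out_arcs C x" "(x, z) \<in> out_arcs C x" using that by (auto simp: V(1))
      ultimately show ?thesis by (metis card_1_singletonE prod.inject singletonD)
    qed
    moreover have "r \<in> U \<longleftrightarrow> v \<in> U" if "\<forall>(x, y)\<in>A. x \<in> U \<longleftrightarrow> y \<in> U" for U
      using V(2) v r(1) that unfolding V(1) by (elim connected_dgD[where P = "\<lambda>x. x \<in> U"]) auto
    ultimately show ?thesis using v r(1) r0 by blast
  qed
  define S where "S = {v. \<forall>y. (v, y) \<notin> A}"
  \<comment> \<open>Outdegree one makes the choice unique; the vertices without outgoing arc become
    the fixed points.\<close>
  define f where "f v = (if v \<in> S then v else (SOME y. (v, y) \<in> A))" for v
  have fA: "(v, f v) \<in> A" if "v \<notin> S" for v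
    using that someI_ex[of "\<lambda>y. (v, y) \<in> A"] by (auto simp: S_def f_def)
  have A: "(x, y) \<in> A \<longleftrightarrow> x \<notin> S \<and> y = f x" for x y
  proof
    assume xy: "(x, y) \<in> A"
    then have "x \<notin> S" by (auto simp: S_def)
    with xy fA[of x] comp[of x] show "x \<notin> S \<and> y = f x" by blast
  qed (use fA in auto)
  have "\<exists>m. (f ^^ m) v \<in> S" for v
  proof -
    obtain r where r: "\<forall>y. (r, y) \<notin> A"
      and inv: "\<forall>U. (\<forall>(x, y)\<in>A. x \<in> U \<longleftrightarrow> y \<in> U) \<longrightarrow> (r \<in> U \<longleftrightarrow> v \<in> U)"
      using comp[of v] by (elim exE conjE) (rule that)
    \<comment> \<open>The vertices whose orbit reaches \<open>r\<close> form an arc-invariant set: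
      as \<open>r\<close> has no outgoing arc, an orbit from \<open>x\<close> to \<open>r\<close>
      passes through \<open>y\<close>. The set contains \<open>r\<close>, hence
      \<open>v\<close>.\<close>
    have "(\<exists>m. (f ^^ m) x = r) \<longleftrightarrow> (\<exists>m. (f ^^ m) y = r)" if xy: "(x, y) \<in> A" for x y
    proof
      assume "\<exists>m. (f ^^ m) x = r"
      then obtain m where m: "(f ^^ m) x = r" ..
      have "m \<noteq> 0" using m r xy by (intro notI) auto
      then obtain k where "m = Suc k" using not0_implies_Suc by blast
      with m xy show "\<exists>m. (f ^^ m) y = r"
        by (auto simp: A funpow_Suc_right simp del: funpow.simps(2))
    next
      assume "\<exists>m. (f ^^ m) y = r"
      then obtain m where "(f ^^ m) (f x) = r" using xy A by auto
      then have "(f ^^ Suc m) x = r" by (simp only: funpow_Suc_right comp_apply)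
      then show "\<exists>m. (f ^^ m) x = r" ..
    qed
    then have "r \<in> {x. \<exists>m. (f ^^ m) x = r} \<longleftrightarrow> v \<in> {x. \<exists>m. (f ^^ m) x = r}"
      by (intro inv[rule_format]) auto
    moreover have "(f ^^ 0) r = r" by simp
    ultimately obtain m where "(f ^^ m) v = r" by blast
    with r show ?thesis by (auto simp: S_def)
  qed
  then have "f \<in> forest_maps S" by (simp add: forest_maps_def f_def)
  moreover have "A = map_arcs S f" using A by auto
  ultimately show ?thesis using that by blast
qed

lemma map_arcs_inj:
  assumes "f \<in> forest_maps S" "g \<in> forest_maps R" "map_arcs S f = map_arcs R g"
  shows "S = R \<and> f = g"
proof -
  have eq: "x \<notin> S \<and> y = f x \<longleftrightarrow> x \<notin> R \<and> y = g x" for x y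
    using assms(3) by (metis in_map_arcs)
  then have "S = R" by blast
  moreover have "f x = g x" for x
    using eq[of x "f x"] forest_maps_fixed[OF assms(1), of x] forest_maps_fixed[OF assms(2), of x] \<open>S = R\<close>
    by (cases "x \<in> S") auto
  ultimately show ?thesis by auto
qed

lemma in_forest_iff:
  fixes T :: "real ^ 'n ^ ('n :: finite)"
  shows "in_forest F (transition_digraph T) \<longleftrightarrow>
    (\<exists>S f. f \<in> forest_maps S \<and> (\<forall>v\<in>-S. T $ v $ f v \<noteq> 0) \<and> F = dg UNIV (map_arcs S f))"
    (is "?L \<longleftrightarrow> ?R")
proof
  assume L: ?L
  then have sp: "spanning F (transition_digraph T)" by (simp add: in_forest_def)
  obtain V A where F: "F = dg V A" "A \<subseteq> {(i, j). i \<noteq> j \<and> T $ i $ j \<noteq> 0}"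
    using sp by (auto simp: spanning_def transition_digraph_def elim!: subgraph_dgE)
  with sp have FU: "F = dg UNIV A" by (auto simp: spanning_def transition_digraph_def)
  obtain S f where f: "f \<in> forest_maps S" "A = map_arcs S f"
  proof (rule forest_map_of_in_forest)
    show "weak_component C (dg UNIV A) \<Longrightarrow> converging_tree C" for C
      using L FU by (simp add: in_forest_def)
  qed
  have "T $ v $ f v \<noteq> 0" if "v \<in> -S" for v
  proof -
    have "(v, f v) \<in> A" using that f(2) by simp
    then show ?thesis using F(2) by auto
  qed
  with f FU show ?R by blast
next
  assume ?R
  then obtain S f where f: "f \<in> forest_maps S" "\<forall>v\<in>-S. T $ v $ f v \<noteq> 0" "F = dg UNIV (map_arcs S f)"
    by blast
  have "v \<noteq> f v" if "v \<notin> S" for v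
    using forest_maps_fixed_iff[OF f(1), of v] that by auto
  then have "spanning F (transition_digraph T)"
    using f(2) by (auto simp: spanning_def transition_digraph_def f(3))
  with f converging_tree_component[OF f(1)] show ?L by (simp add: in_forest_def)
qed

text \<open>Each vertex other than a root contributes one arc, so \<open>c\<close> roots mean
  \<open>n - c\<close> arcs. With integer indices the case \<open>n = 1\<close>,
  \<open>c = 2\<close> is covered, both sides being empty sums.\<close>

lemma in_forest_weight_eq:
  fixes T :: "real ^ 'n ^ ('n :: finite)"
  shows "in_forest_weight T (int CARD('n) - int c) =
    (\<Sum>S | card S = c. \<Sum>f\<in>forest_maps S. map_weight T S f)"
proof -
  let ?P = "SIGMA S:{S. card S = c}. {f \<in> forest_maps S. \<forall>v\<in>-S. T $ v $ f v \<noteq> 0}"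
  let ?h = "\<lambda>(S, f). dg UNIV (map_arcs S f)"
  have card: "int (card (map_arcs S f)) = int CARD('n) - int (card S)" for S :: "'n set" and f
  proof -
    have "card (map_arcs S f) = card (- S)"
      unfolding map_arcs_def by (intro card_image inj_onI) auto
    also have "\<dots> = CARD('n) - card S"
      by (simp add: Compl_eq_Diff_UNIV card_Diff_subset)
    finally show ?thesis by (simp add: of_nat_diff card_mono)
  qed
  have "bij_betw ?h ?P {F. in_forest F (transition_digraph T) \<and> int (card (arcs F)) = int CARD('n) - int c}"
  proof (rule bij_betw_imageI)
    show "inj_on ?h ?P"
      by (rule inj_onI) (auto dest: map_arcs_inj)
    show "?h ` ?P = {F. in_forest F (transition_digraph T) \<and> int (card (arcs F)) = int CARD('n) - int c}"
    proof (intro equalityI subsetI)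
      fix F assume "F \<in> ?h ` ?P"
      then obtain S f where "f \<in> forest_maps S" "card S = c" "\<forall>v\<in>-S. T $ v $ f v \<noteq> 0"
        "F = dg UNIV (map_arcs S f)" by auto
      then show "F \<in> {F. in_forest F (transition_digraph T) \<and> int (card (arcs F)) = int CARD('n) - int c}"
        using card[of S f] by (auto simp: in_forest_iff)
    next
      fix F assume "F \<in> {F. in_forest F (transition_digraph T) \<and> int (card (arcs F)) = int CARD('n) - int c}"
      then obtain S f where "f \<in> forest_maps S" "\<forall>v\<in>-S. T $ v $ f v \<noteq> 0" "F = dg UNIV (map_arcs S f)"
        "int (card (arcs F)) = int CARD('n) - int c" by (auto simp: in_forest_iff)
      then show "F \<in> ?h ` ?P"
        using card[of S f] by (intro image_eqI[of _ _ "(S, f)"]) auto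
    qed
  qed
  then have "in_forest_weight T (int CARD('n) - int c) =
      (\<Sum>p\<in>?P. digraph_weight (arc_weight T) (?h p))"
    unfolding in_forest_weight_def by (rule sum.reindex_bij_betw[symmetric])
  also have "\<dots> = (\<Sum>(S, f)\<in>?P. map_weight T S f)"
  proof (intro sum.cong refl, clarify)
    fix S :: "'n set" and f
    show "digraph_weight (arc_weight T) (dg UNIV (map_arcs S f)) = map_weight T S f"
      unfolding digraph_weight_def arc_weight_def map_weight_def map_arcs_def
      by (simp, subst prod.reindex) (auto intro: inj_onI)
  qed
  also have "\<dots> = (\<Sum>S | card S = c. \<Sum>f | f \<in> forest_maps S \<and> (\<forall>v\<in>-S. T $ v $ f v \<noteq> 0). map_weight T S f)"
    by (subst sum.Sigma) auto
  also have "\<dots> = (\<Sum>S | card S = c. \<Sum>f\<in>forest_maps S. map_weight T S f)"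
    by (intro sum.cong refl sum.mono_neutral_left) (auto simp: map_weight_def)
  finally show ?thesis .
qed


section \<open>Hitting times\<close>

text \<open>\<open>survival T j p i\<close> is the probability that \<open>j\<close> is not visited at the times \<open>1, \<dots>, p\<close>, starting from \<open>i\<close>.\<close>

fun survival :: "real ^ 'n ^ 'n \<Rightarrow> 'n \<Rightarrow> nat \<Rightarrow> ('n :: finite) \<Rightarrow> real" where
  "survival T j 0 i = 1"
| "survival T j (Suc p) i = (\<Sum>v\<in>-{j}. T $ i $ v * survival T j p v)"

lemma survival_nonneg: "stochastic_matrix T \<Longrightarrow> 0 \<le> survival T j p i"
  by (induction p arbitrary: i) (auto simp: stochastic_matrix_def intro!: sum_nonneg)

lemma survival_Suc_le:
  assumes T: "stochastic_matrix T"
  shows "survival T j (Suc p) i \<le> survival T j p i"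
proof (induction p arbitrary: i)
  case 0
  have "(\<Sum>v\<in>-{j}. T $ i $ v) \<le> (\<Sum>v\<in>UNIV. T $ i $ v)"
    using T by (intro sum_mono2) (auto simp: stochastic_matrix_def)
  then show ?case using T by (simp add: stochastic_matrix_def)
next
  case (Suc p)
  show ?case
    unfolding survival.simps(2)[of T j "Suc p"] survival.simps(2)[of T j p i]
    using T Suc by (intro sum_mono mult_left_mono) (auto simp: stochastic_matrix_def)
qed

text \<open>Unfolding the equation bounds the partial sums by \<open>h i / q\<close>. Hence the
  series converges, \<open>survival\<close> tends to 0, and so does the remainder, which is at most
  \<open>C\<close> times it.\<close>

lemma survival_sums:
  fixes T :: "real ^ 'n ^ ('n :: finite)"
  assumes T: "stochastic_matrix T" and q: "0 < q" and h0: "\<And>i. 0 \<le> h i"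
    and h: "\<And>i. h i = q + (\<Sum>v\<in>-{j}. T $ i $ v * h v)"
  shows "(\<lambda>p. survival T j p i) sums (h i / q)"
proof -
  define C where "C = Max (range h)"
  have C: "h v \<le> C" for v unfolding C_def by (intro Max_ge) auto
  \<comment> \<open>\<open>e\<close> is the remainder after unfolding the equation for \<open>h\<close> \<open>N\<close> times\<close>
  have iter: "\<exists>e. 0 \<le> e \<and> e \<le> C * survival T j N i \<and> h i = q * (\<Sum>p<N. survival T j p i) + e" for N i
  proof (induction N arbitrary: i)
    case 0
    show ?case using h0 C by (intro exI[of _ "h i"]) simp
  next
    case (Suc N)
    then obtain e where e: "\<And>v. 0 \<le> e v" "\<And>v. e v \<le> C * survival T j N v"
      "\<And>v. h v = q * (\<Sum>p<N. survival T j p v) + e v" by metis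
    have T0: "0 \<le> T $ i $ v" for v using T by (simp add: stochastic_matrix_def)
    have "h i = q + (\<Sum>v\<in>-{j}. T $ i $ v * (q * (\<Sum>p<N. survival T j p v) + e v))"
      by (subst h, subst e(3), rule refl)
    also have "\<dots> = q + (q * (\<Sum>p<N. survival T j (Suc p) i) + (\<Sum>v\<in>-{j}. T $ i $ v * e v))"
      by (simp add: distrib_left sum.distrib sum_distrib_left sum.swap[of _ _ "{..<N}"] mult_ac)
    also have "\<dots> = q * (\<Sum>p<Suc N. survival T j p i) + (\<Sum>v\<in>-{j}. T $ i $ v * e v)"
      by (simp add: sum.lessThan_Suc_shift distrib_left del: sum.lessThan_Suc survival.simps(2))
    finally have "h i = q * (\<Sum>p<Suc N. survival T j p i) + (\<Sum>v\<in>-{j}. T $ i $ v * e v)" .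
    moreover have "(\<Sum>v\<in>-{j}. T $ i $ v * e v) \<le> (\<Sum>v\<in>-{j}. T $ i $ v * (C * survival T j N v))"
      using e(2) T0 by (intro sum_mono mult_left_mono)
    moreover have "\<dots> = C * survival T j (Suc N) i"
      by (simp add: sum_distrib_left mult_ac)
    moreover have "0 \<le> (\<Sum>v\<in>-{j}. T $ i $ v * e v)"
      using e(1) T0 by (intro sum_nonneg) simp
    ultimately show ?case by metis
  qed
  have bound: "(\<Sum>p<N. survival T j p i) \<le> h i / q" for N
    using iter[of N i] q by (auto simp: field_simps)
  have summable: "summable (\<lambda>p. survival T j p i)"
    by (rule summableI_nonneg_bounded[OF survival_nonneg[OF T] bound])
  have "(\<lambda>N. h i / q - C / q * survival T j N i) \<longlonglongrightarrow> h i / q - C / q * 0"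
    by (intro tendsto_intros summable_LIMSEQ_zero summable)
  then have lower: "(\<lambda>N. h i / q - C / q * survival T j N i) \<longlonglongrightarrow> h i / q" by simp
  have "h i / q - C / q * survival T j N i \<le> (\<Sum>p<N. survival T j p i)" for N
    using iter[of N i] q by (auto simp: field_simps)
  then have "(\<lambda>N. \<Sum>p<N. survival T j p i) \<longlonglongrightarrow> h i / q"
    using bound by (intro tendsto_sandwich[OF _ _ lower tendsto_const]) simp_all
  then show ?thesis by (simp add: sums_def)
qed

text \<open>The tail formula for an expectation: \<open>u p\<close> is the probability of exceeding
  \<open>p\<close>, and \<open>u (k - 1) - u k\<close> that of the value \<open>k\<close>.\<close>

lemma sums_by_tails:
  fixes u :: "nat \<Rightarrow> real"
  assumes dec: "\<And>p. u (Suc p) \<le> u p" and u0: "\<And>p. 0 \<le> u p" and S: "u sums S"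
  shows "(\<lambda>k. real k * (u (k - 1) - u k)) sums S"
proof -
  define P where "P N = (\<Sum>k<N. real k * (u (k - 1) - u k))" for N
  \<comment> \<open>Summation by parts; the term for \<open>k = 0\<close>, where
    \<open>k - 1\<close> is 0, vanishes.\<close>
  have P: "P (Suc N) = (\<Sum>p<N. u p - u N)" for N
    by (induction N) (simp_all add: P_def sum_subtractf algebra_simps)
  have anti: "u n \<le> u m" if "m \<le> n" for m n
    using dec that by (rule lift_Suc_antimono_le)
  have part: "(\<Sum>p<N. u p) \<le> S" for N
    using S u0 by (metis sum_le_suminf finite_lessThan sums_iff)
  have "P (Suc N) \<le> S" for N
    unfolding P by (rule order_trans[OF sum_mono part]) (simp add: u0)
  moreover have inc: "incseq (\<lambda>N. P (Suc N))"
    by (intro incseq_SucI) (use dec in \<open>simp add: P_def\<close>)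
  ultimately obtain L where L: "(\<lambda>N. P (Suc N)) \<longlonglongrightarrow> L" "\<forall>N. P (Suc N) \<le> L"
    using incseq_convergent[OF inc, of S] by blast
  have "L \<le> S" using L(1) \<open>\<And>N. P (Suc N) \<le> S\<close> by (intro LIMSEQ_le_const2) auto
  moreover have "S \<le> L"
  proof (rule LIMSEQ_le_const2)
    show "(\<lambda>N. \<Sum>p<N. u p) \<longlonglongrightarrow> S" using S by (simp add: sums_def)
    \<comment> \<open>The boundary term \<open>N * u N\<close> is controlled by keeping only the
      first \<open>m\<close> summands while \<open>N\<close> grows.\<close>
    have "(\<Sum>p<m. u p) \<le> L" for m
    proof (rule LIMSEQ_le_const2)
      have "u \<longlonglongrightarrow> 0" using S by (intro summable_LIMSEQ_zero) (simp add: sums_iff)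
      then have "(\<lambda>N. \<Sum>p<m. u p - u N) \<longlonglongrightarrow> (\<Sum>p<m. u p - 0)" by (intro tendsto_intros)
      then show "(\<lambda>N. \<Sum>p<m. u p - u N) \<longlonglongrightarrow> (\<Sum>p<m. u p)" by simp
      have "(\<Sum>p<m. u p - u N) \<le> L" if "m \<le> N" for N
      proof -
        have "(\<Sum>p<m. u p - u N) \<le> (\<Sum>p<N. u p - u N)"
          using that anti by (intro sum_mono2) auto
        then show ?thesis using L(2) P by (metis order_trans)
      qed
      then show "\<exists>N. \<forall>n\<ge>N. (\<Sum>p<m. u p - u n) \<le> L" by blast
    qed
    then show "\<exists>N. \<forall>n\<ge>N. (\<Sum>p<n. u p) \<le> L" by blast
  qed
  ultimately have "(\<lambda>N. P (Suc N)) \<longlonglongrightarrow> S" using L(1) by simp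
  then have "P \<longlonglongrightarrow> S" by (simp only: filterlim_sequentially_Suc)
  then show ?thesis unfolding sums_def P_def[symmetric] .
qed

lemma hitting_time_eq_Suc:
  "hitting_time X j \<omega> = enat (Suc k) \<longleftrightarrow> X (Suc k) \<omega> = j \<and> (\<forall>q\<in>{1..k}. X q \<omega> \<noteq> j)"
proof -
  let ?A = "{enat p | p. p > 0 \<and> X p \<omega> = j}"
  show ?thesis
  proof
    assume H: "hitting_time X j \<omega> = enat (Suc k)"
    \<comment> \<open>The infimum of the empty set is infinite.\<close>
    have "?A \<noteq> {}"
    proof
      assume "?A = {}"
      then have "Inf {} = enat (Suc k)" using H unfolding hitting_time_def by (simp only:)
      then show False by (simp add: Inf_enat_def)
    qed
    then obtain x where "x \<in> ?A" by (rule ex_in_conv[THEN iffD2, THEN exE])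
    then have "Inf ?A \<in> ?A" by (rule wellorder_InfI)
    then have "enat (Suc k) \<in> ?A" using H unfolding hitting_time_def by (simp only:)
    moreover have False if q: "q \<in> {1..k}" "X q \<omega> = j" for q
    proof -
      have "Inf ?A \<le> enat q" using q by (intro wellorder_Inf_le1) auto
      with H have "enat (Suc k) \<le> enat q" unfolding hitting_time_def by (simp only:)
      with q show False by simp
    qed
    ultimately show "X (Suc k) \<omega> = j \<and> (\<forall>q\<in>{1..k}. X q \<omega> \<noteq> j)" by blast
  next
    assume R: "X (Suc k) \<omega> = j \<and> (\<forall>q\<in>{1..k}. X q \<omega> \<noteq> j)"
    show "hitting_time X j \<omega> = enat (Suc k)"
      unfolding hitting_time_def
    proof (rule antisym)
      show "Inf ?A \<le> enat (Suc k)" using R by (intro wellorder_Inf_le1) auto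
      show "enat (Suc k) \<le> Inf ?A"
      proof (rule Inf_greatest)
        fix x assume "x \<in> ?A"
        then obtain p where p: "x = enat p" "p > 0" "X p \<omega> = j" by auto
        then have "\<not> p \<le> k" using R by auto
        with p show "enat (Suc k) \<le> x" by simp
      qed
    qed
  qed
qed

section \<open>Path probabilities of the chain\<close>

text \<open>The Markov property conditions on complete histories, so the event is split into the
  finitely many histories up to time \<open>p\<close>.\<close>

lemma markov_chain_avoid_step:
  fixes X :: "nat \<Rightarrow> 'w \<Rightarrow> 'n :: finite"
  assumes mc: "markov_chain M X T"
  shows "\<P>(\<omega> in M. (X 0 \<omega> = i \<and> (\<forall>q\<in>{1..p}. X q \<omega> \<noteq> j)) \<and> X p \<omega> = u \<and> X (Suc p) \<omega> = v) =
         T $ u $ v * \<P>(\<omega> in M. (X 0 \<omega> = i \<and> (\<forall>q\<in>{1..p}. X q \<omega> \<noteq> j)) \<and> X p \<omega> = u)"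
proof -
  interpret prob_space M using mc by (simp add: markov_chain_def)
  have X [measurable]: "X q \<in> measurable M (count_space UNIV)" for q
    using mc by (simp add: markov_chain_def)
  \<comment> \<open>Extensional functions on \<open>{..p}\<close>, so that every outcome has exactly
    one history in \<open>H\<close>.\<close>
  define H where "H = PiE {..p} (\<lambda>_. UNIV :: 'n set)"
  have finH: "finite H" unfolding H_def by (intro finite_PiE) auto
  define Q where "Q x \<longleftrightarrow> (x 0 = i \<and> (\<forall>q\<in>{1..p}. x q \<noteq> j)) \<and> x p = u" for x :: "nat \<Rightarrow> 'n"
  have ex1: "\<exists>!x. x \<in> H \<and> (\<forall>q\<le>p. X q \<omega> = x q)" for \<omega>
  proof (rule ex1I[of _ "restrict (\<lambda>q. X q \<omega>) {..p}"])
    fix x assume x: "x \<in> H \<and> (\<forall>q\<le>p. X q \<omega> = x q)"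
    then have "x \<in> extensional {..p}" by (simp add: H_def PiE_def)
    then show "x = restrict (\<lambda>q. X q \<omega>) {..p}"
      using x by (auto simp: restrict_def extensional_def)
  qed (simp add: H_def)
  have Qx: "Q (\<lambda>q. X q \<omega>) \<longleftrightarrow> Q x" if "\<forall>q\<le>p. X q \<omega> = x q" for x \<omega>
    using that unfolding Q_def by auto
  have split: "\<P>(\<omega> in M. Q (\<lambda>q. X q \<omega>) \<and> R \<omega>) = (\<Sum>x | x \<in> H \<and> Q x. \<P>(\<omega> in M. (\<forall>q\<le>p. X q \<omega> = x q) \<and> R \<omega>))"
    if [measurable]: "Measurable.pred M R" for R
  proof (rule prob_sum)
    show "finite {x. x \<in> H \<and> Q x}" using finH by simp
    show "{\<omega> \<in> space M. (\<forall>q\<le>p. X q \<omega> = x q) \<and> R \<omega>} \<in> events" for x by measurable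
    show "{\<omega> \<in> space M. Q (\<lambda>q. X q \<omega>) \<and> R \<omega>} \<in> events" unfolding Q_def by measurable
    have "(\<forall>x\<in>{x. x \<in> H \<and> Q x}. (\<forall>q\<le>p. X q \<omega> = x q) \<and> R \<omega> \<longrightarrow> Q (\<lambda>q. X q \<omega>) \<and> R \<omega>) \<and>
      (Q (\<lambda>q. X q \<omega>) \<and> R \<omega> \<longrightarrow> (\<exists>!x\<in>{x. x \<in> H \<and> Q x}. (\<forall>q\<le>p. X q \<omega> = x q) \<and> R \<omega>))" for \<omega>
    proof (intro conjI ballI impI)
      fix x assume "x \<in> {x. x \<in> H \<and> Q x}" "(\<forall>q\<le>p. X q \<omega> = x q) \<and> R \<omega>"
      then show "Q (\<lambda>q. X q \<omega>)" "R \<omega>" using Qx[of \<omega> x] by simp_all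
    next
      assume QR: "Q (\<lambda>q. X q \<omega>) \<and> R \<omega>"
      obtain x where x: "x \<in> H" "\<forall>q\<le>p. X q \<omega> = x q"
        and uniq: "\<And>y. y \<in> H \<and> (\<forall>q\<le>p. X q \<omega> = y q) \<Longrightarrow> y = x"
        using ex1[of \<omega>] by (elim ex1E) blast
      show "\<exists>!x\<in>{x. x \<in> H \<and> Q x}. (\<forall>q\<le>p. X q \<omega> = x q) \<and> R \<omega>"
      proof (rule ex1I[of _ x])
        show "x \<in> {x. x \<in> H \<and> Q x} \<and> (\<forall>q\<le>p. X q \<omega> = x q) \<and> R \<omega>"
          using x QR Qx[OF x(2)] by simp
      qed (rule uniq, simp)
    qed
    then show "AE \<omega> in M. (\<forall>x\<in>{x. x \<in> H \<and> Q x}. (\<forall>q\<le>p. X q \<omega> = x q) \<and> R \<omega> \<longrightarrow> Q (\<lambda>q. X q \<omega>) \<and> R \<omega>) \<and>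
      (Q (\<lambda>q. X q \<omega>) \<and> R \<omega> \<longrightarrow> (\<exists>!x\<in>{x. x \<in> H \<and> Q x}. (\<forall>q\<le>p. X q \<omega> = x q) \<and> R \<omega>))" by simp
  qed
  have step: "\<P>(\<omega> in M. (\<forall>q\<le>p. X q \<omega> = x q) \<and> X (Suc p) \<omega> = v) =
       T $ u $ v * \<P>(\<omega> in M. \<forall>q\<le>p. X q \<omega> = x q)" if "Q x" for x
  proof (cases "\<P>(\<omega> in M. \<forall>q\<le>p. X q \<omega> = x q) > 0")
    case True
    then have "\<P>(\<omega> in M. X (Suc p) \<omega> = v \<bar> \<forall>q\<le>p. X q \<omega> = x q) = T $ x p $ v"
      using mc unfolding markov_chain_def by blast
    then have "\<P>(\<omega> in M. X (Suc p) \<omega> = v \<and> (\<forall>q\<le>p. X q \<omega> = x q)) = T $ x p $ v * \<P>(\<omega> in M. \<forall>q\<le>p. X q \<omega> = x q)"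
      using True by (simp add: cond_prob_def field_simps)
    then show ?thesis using that by (simp add: Q_def conj_commute)
  next
    \<comment> \<open>A history of probability 0 escapes the Markov property, but both sides
      vanish.\<close>
    case False
    then have zero: "\<P>(\<omega> in M. \<forall>q\<le>p. X q \<omega> = x q) = 0"
      by (simp add: zero_less_measure_iff)
    have "\<P>(\<omega> in M. (\<forall>q\<le>p. X q \<omega> = x q) \<and> X (Suc p) \<omega> = v) \<le> \<P>(\<omega> in M. \<forall>q\<le>p. X q \<omega> = x q)"
      by (intro finite_measure_mono) auto
    then have "\<P>(\<omega> in M. (\<forall>q\<le>p. X q \<omega> = x q) \<and> X (Suc p) \<omega> = v) = 0"
      unfolding zero by (rule order_antisym) simp
    with zero show ?thesis by simp
  qed
  have "\<P>(\<omega> in M. Q (\<lambda>q. X q \<omega>) \<and> X (Suc p) \<omega> = v) = T $ u $ v * \<P>(\<omega> in M. Q (\<lambda>q. X q \<omega>) \<and> True)"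
    by (subst (1 2) split) (auto simp: sum_distrib_left step intro!: sum.cong)
  then show ?thesis by (simp add: Q_def conj_assoc)
qed

text \<open>The first \<open>p\<close> steps are taken by the chain, the other \<open>k\<close> by
  the recursion of \<open>survival\<close>. Raising \<open>p\<close> converts one step at a time;
  \<open>k = 0\<close> gives \<open>prob_survival\<close>.\<close>

lemma markov_chain_avoid_sum:
  fixes X :: "nat \<Rightarrow> 'w \<Rightarrow> 'n :: finite"
  assumes mc: "markov_chain M X T"
  shows "(\<Sum>v\<in>UNIV. \<P>(\<omega> in M. (X 0 \<omega> = i \<and> (\<forall>q\<in>{1..p}. X q \<omega> \<noteq> j)) \<and> X p \<omega> = v) * survival T j k v) =
         \<P>(\<omega> in M. X 0 \<omega> = i) * survival T j (p + k) i"
proof (induction p arbitrary: k)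
  case 0
  have "(\<Sum>v\<in>UNIV. \<P>(\<omega> in M. X 0 \<omega> = i \<and> X 0 \<omega> = v) * survival T j k v) =
     (\<Sum>v\<in>{i}. \<P>(\<omega> in M. X 0 \<omega> = i \<and> X 0 \<omega> = v) * survival T j k v)"
  proof (rule sum.mono_neutral_right)
    show "\<forall>v\<in>UNIV - {i}. \<P>(\<omega> in M. X 0 \<omega> = i \<and> X 0 \<omega> = v) * survival T j k v = 0"
    proof
      fix v assume "v \<in> UNIV - {i}"
      then have "{\<omega> \<in> space M. X 0 \<omega> = i \<and> X 0 \<omega> = v} = {}" by auto
      then show "\<P>(\<omega> in M. X 0 \<omega> = i \<and> X 0 \<omega> = v) * survival T j k v = 0"
        by (simp only: measure_empty)
    qed
  qed auto
  then show ?case by simp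
next
  case (Suc p)
  interpret prob_space M using mc by (simp add: markov_chain_def)
  have X [measurable]: "X q \<in> measurable M (count_space UNIV)" for q
    using mc by (simp add: markov_chain_def)
  let ?A = "\<lambda>p \<omega>. X 0 \<omega> = i \<and> (\<forall>q\<in>{1..p}. X q \<omega> \<noteq> j)"
  have A: "?A (Suc p) \<omega> \<longleftrightarrow> ?A p \<omega> \<and> X (Suc p) \<omega> \<noteq> j" for \<omega>
    by (auto simp: atLeastAtMostSuc_conv)
  have a: "\<P>(\<omega> in M. ?A (Suc p) \<omega> \<and> X (Suc p) \<omega> = v) =
     of_bool (v \<noteq> j) * (\<Sum>u\<in>UNIV. T $ u $ v * \<P>(\<omega> in M. ?A p \<omega> \<and> X p \<omega> = u))" for v
  proof (cases "v = j")
    case True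
    then have "{\<omega> \<in> space M. ?A (Suc p) \<omega> \<and> X (Suc p) \<omega> = v} = {}" by auto
    then show ?thesis using True by (simp only: measure_empty) simp
  next
    case False
    then have "\<P>(\<omega> in M. ?A (Suc p) \<omega> \<and> X (Suc p) \<omega> = v) = \<P>(\<omega> in M. ?A p \<omega> \<and> X (Suc p) \<omega> = v)"
      unfolding A by (intro arg_cong[where f = "measure M"]) auto
    also have "\<dots> = (\<Sum>u\<in>UNIV. \<P>(\<omega> in M. ?A p \<omega> \<and> X p \<omega> = u \<and> X (Suc p) \<omega> = v))"
      by (rule prob_sum) auto
    also have "\<dots> = (\<Sum>u\<in>UNIV. T $ u $ v * \<P>(\<omega> in M. ?A p \<omega> \<and> X p \<omega> = u))"
      by (intro sum.cong refl markov_chain_avoid_step[OF mc])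
    finally show ?thesis using False by simp
  qed
  have "(\<Sum>v\<in>UNIV. \<P>(\<omega> in M. ?A (Suc p) \<omega> \<and> X (Suc p) \<omega> = v) * survival T j k v) =
    (\<Sum>v\<in>-{j}. \<Sum>u\<in>UNIV. \<P>(\<omega> in M. ?A p \<omega> \<and> X p \<omega> = u) * (T $ u $ v * survival T j k v))"
    unfolding a by (intro sum.mono_neutral_cong_right) (auto simp: sum_distrib_left sum_distrib_right mult_ac)
  also have "\<dots> = (\<Sum>u\<in>UNIV. \<P>(\<omega> in M. ?A p \<omega> \<and> X p \<omega> = u) * survival T j (Suc k) u)"
    by (subst sum.swap) (simp add: sum_distrib_left)
  also have "\<dots> = \<P>(\<omega> in M. X 0 \<omega> = i) * survival T j (Suc p + k) i"
    by (subst Suc.IH) simp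
  finally show ?case .
qed

lemma prob_survival:
  fixes X :: "nat \<Rightarrow> 'w \<Rightarrow> 'n :: finite"
  assumes mc: "markov_chain M X T"
  shows "\<P>(\<omega> in M. X 0 \<omega> = i \<and> (\<forall>q\<in>{1..p}. X q \<omega> \<noteq> j)) = \<P>(\<omega> in M. X 0 \<omega> = i) * survival T j p i"
proof -
  interpret prob_space M using mc by (simp add: markov_chain_def)
  have X [measurable]: "X q \<in> measurable M (count_space UNIV)" for q
    using mc by (simp add: markov_chain_def)
  have "\<P>(\<omega> in M. X 0 \<omega> = i \<and> (\<forall>q\<in>{1..p}. X q \<omega> \<noteq> j)) =
    (\<Sum>v\<in>UNIV. \<P>(\<omega> in M. (X 0 \<omega> = i \<and> (\<forall>q\<in>{1..p}. X q \<omega> \<noteq> j)) \<and> X p \<omega> = v))"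
    by (rule prob_sum) auto
  then show ?thesis
    using markov_chain_avoid_sum[OF mc, of i p j 0] by simp
qed

lemma mean_hitting_time_eq:
  fixes X :: "nat \<Rightarrow> 'w \<Rightarrow> 'n :: finite"
  assumes mc: "markov_chain M X T" and T: "stochastic_matrix T"
    and i: "\<P>(\<omega> in M. X 0 \<omega> = i) > 0" and S: "(\<lambda>p. survival T j p i) sums S"
  shows "mean_hitting_time M X i j = ennreal S"
proof -
  interpret prob_space M using mc by (simp add: markov_chain_def)
  have X [measurable]: "X q \<in> measurable M (count_space UNIV)" for q
    using mc by (simp add: markov_chain_def)
  let ?s = "\<lambda>p. survival T j p i" and ?c = "\<P>(\<omega> in M. X 0 \<omega> = i)"
  let ?A = "\<lambda>p \<omega>. X 0 \<omega> = i \<and> (\<forall>q\<in>{1..p}. X q \<omega> \<noteq> j)"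
  have cond: "\<P>(\<omega> in M. hitting_time X j \<omega> = enat (Suc k) \<bar> X 0 \<omega> = i) = ?s k - ?s (Suc k)" for k
  proof -
    \<comment> \<open>The first hit occurs at \<open>Suc k\<close> if \<open>j\<close> is avoided up
      to \<open>k\<close> but not up to \<open>Suc k\<close>.\<close>
    have diff: "{\<omega> \<in> space M. hitting_time X j \<omega> = enat (Suc k) \<and> X 0 \<omega> = i} =
        {\<omega> \<in> space M. ?A k \<omega>} - {\<omega> \<in> space M. ?A (Suc k) \<omega>}"
      by (auto simp: hitting_time_eq_Suc atLeastAtMostSuc_conv)
    have "\<P>(\<omega> in M. hitting_time X j \<omega> = enat (Suc k) \<and> X 0 \<omega> = i) =
        \<P>(\<omega> in M. ?A k \<omega>) - \<P>(\<omega> in M. ?A (Suc k) \<omega>)"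
      unfolding diff by (rule finite_measure_Diff) auto
    then have "\<P>(\<omega> in M. hitting_time X j \<omega> = enat (Suc k) \<and> X 0 \<omega> = i) = ?c * (?s k - ?s (Suc k))"
      unfolding prob_survival[OF mc, of i k j] prob_survival[OF mc, of i "Suc k" j]
      by (simp only: right_diff_distrib)
    then show ?thesis using i unfolding cond_prob_def by (simp del: survival.simps)
  qed
  have "of_nat k * ennreal \<P>(\<omega> in M. hitting_time X j \<omega> = enat k \<bar> X 0 \<omega> = i) =
      ennreal (real k * (?s (k - 1) - ?s k))" for k
  proof (cases k)
    case (Suc m)
    then show ?thesis
      using survival_Suc_le[OF T, of j m i]
      by (simp add: cond ennreal_mult ennreal_of_nat_eq_real_of_nat del: survival.simps of_nat_Suc)
  qed simp
  then have "mean_hitting_time M X i j = (\<Sum>k. ennreal (real k * (?s (k - 1) - ?s k)))"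
    by (simp add: mean_hitting_time_def)
  also have "\<dots> = ennreal S"
  proof (rule suminf_ennreal_eq)
    show "0 \<le> real k * (?s (k - 1) - ?s k)" for k
      using survival_Suc_le[OF T, of j "k - 1" i] by (cases k) (simp_all del: survival.simps)
    show "(\<lambda>k. real k * (?s (k - 1) - ?s k)) sums S"
      by (rule sums_by_tails[OF survival_Suc_le[OF T] survival_nonneg[OF T] S])
  qed
  finally show ?thesis .
qed


section \<open>Kemeny's constant\<close>

theorem corollary2:
  fixes T :: "real ^ 'n ^ 'n"
    and M :: "'w measure"
    and X :: "nat \<Rightarrow> 'w \<Rightarrow> 'n :: finite"
    and \<pi> :: "real ^ 'n"
  assumes "stochastic_matrix T"
    and "irreducible_matrix T"
    and "markov_chain M X T"
    and "normalized_left_perron_vector T \<pi>"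
  shows "\<forall>i. \<P>(\<omega> in M. X 0 \<omega> = i) > 0 \<longrightarrow>
           kemeny_constant M X \<pi> i =
             ennreal (1 + in_forest_weight T (int CARD('n) - 2) / in_forest_weight T (int CARD('n) - 1))"
proof (intro allI impI)
  fix i assume i: "\<P>(\<omega> in M. X 0 \<omega> = i) > 0"
  note T = assms(1)
  have \<pi>: "\<pi> v* T = \<pi>" "\<And>k. 0 \<le> \<pi> $ k" "(\<Sum>k\<in>UNIV. \<pi> $ k) = 1"
    using assms(4) by (auto simp: normalized_left_perron_vector_def)
  define \<sigma> where "\<sigma> = (\<Sum>r\<in>UNIV. tree_sum T r)"
  \<comment> \<open>\<open>h j\<close> agrees with \<open>hit_sum T j\<close> except at
    \<open>j\<close>, where it is \<open>\<sigma>\<close> instead of 0. Thus the first-step equation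
    also holds for the return to \<open>j\<close>.\<close>
  define h where "h j k = tree_sum T j + (\<Sum>v\<in>-{j}. T $ k $ v * hit_sum T j v)" for j k
  have q: "0 < tree_sum T j" for j
    using tree_sum_pos[OF T assms(2)] .
  have \<sigma>: "0 < \<sigma>" unfolding \<sigma>_def by (intro sum_pos q) auto
  have drop: "(\<Sum>v\<in>UNIV. T $ k $ v * hit_sum T j v) = (\<Sum>v\<in>-{j}. T $ k $ v * hit_sum T j v)" for j k
    by (intro sum.mono_neutral_right) auto
  have h_off: "h j k = hit_sum T j k" if "k \<noteq> j" for j k
    using hit_sum_step[OF T that] by (simp add: h_def drop)
  have h_diag: "h j j = \<sigma>" for j
    unfolding h_def \<sigma>_def sum_tree_sum[of T j] drop ..
  have h_step: "h j k = tree_sum T j + (\<Sum>v\<in>-{j}. T $ k $ v * h j v)" for j k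
    unfolding h_def[of j k] by (intro arg_cong2[where f = "(+)"] sum.cong refl) (simp add: h_off)
  have h0: "0 \<le> h j k" for j k
    using h_off[of k j] h_diag[of j] \<sigma> hit_sum_nonneg[OF T, of j k] by (cases "k = j") auto
  have mean: "mean_hitting_time M X i j = ennreal (h j i / tree_sum T j)" for j
    by (intro mean_hitting_time_eq[OF assms(3) T i] survival_sums[OF T q h0 h_step])
  \<comment> \<open>Averaging the first-step equation over \<open>\<pi>\<close> gives, by
    stationarity, the same sum on both sides up to the term at \<open>j\<close>; what remains is
    \<open>\<pi> $ j * \<sigma> = tree_sum T j\<close>.\<close>
  have \<pi>_eq: "\<pi> $ j = tree_sum T j / \<sigma>" for j
  proof -
    have col: "(\<Sum>k\<in>UNIV. \<pi> $ k * T $ k $ v) = \<pi> $ v" for v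
      using \<pi>(1) by (metis (no_types, lifting) mult.commute sum.cong vector_matrix_mult_def vec_lambda_beta)
    have "(\<Sum>k\<in>UNIV. \<pi> $ k * h j k) = (\<Sum>k\<in>UNIV. \<pi> $ k * (tree_sum T j + (\<Sum>v\<in>-{j}. T $ k $ v * h j v)))"
      by (subst h_step) (rule refl)
    also have "\<dots> = tree_sum T j + (\<Sum>k\<in>UNIV. \<Sum>v\<in>-{j}. \<pi> $ k * T $ k $ v * h j v)"
      by (simp add: distrib_left sum.distrib sum_distrib_right[symmetric] \<pi>(3) sum_distrib_left mult.assoc)
    also have "\<dots> = tree_sum T j + (\<Sum>v\<in>-{j}. \<pi> $ v * h j v)"
      by (subst sum.swap) (simp add: sum_distrib_right[symmetric] col)
    also have "(\<Sum>v\<in>-{j}. \<pi> $ v * h j v) = (\<Sum>k\<in>UNIV. \<pi> $ k * h j k) - \<pi> $ j * \<sigma>"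
      by (simp add: Compl_eq_Diff_UNIV sum_diff1 h_diag)
    finally show ?thesis using \<sigma> by (simp add: field_simps)
  qed
  have "kemeny_constant M X \<pi> i = (\<Sum>j\<in>UNIV. ennreal (\<pi> $ j * (h j i / tree_sum T j)))"
    unfolding kemeny_constant_def mean
    by (intro sum.cong refl ennreal_mult[symmetric] \<pi>(2)) (simp add: h0 q less_imp_le)
  also have "\<dots> = ennreal (\<Sum>j\<in>UNIV. \<pi> $ j * (h j i / tree_sum T j))"
    by (intro sum_ennreal) (simp add: \<pi>(2) h0 q less_imp_le)
  also have "(\<Sum>j\<in>UNIV. \<pi> $ j * (h j i / tree_sum T j)) = (\<Sum>j\<in>UNIV. h j i / \<sigma>)"
    using q by (intro sum.cong refl) (simp add: \<pi>_eq less_imp_neq[THEN not_sym])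
  \<comment> \<open>The summand 1 of the formula is the return term \<open>h i i / \<sigma>\<close>;
    \<open>hit_sum T i i\<close> is 0, so the other sum may include \<open>j = i\<close>.\<close>
  also have "\<dots> = (\<Sum>j\<in>UNIV. of_bool (j = i) + hit_sum T j i / \<sigma>)"
    using \<sigma> h_off[of i] by (intro sum.cong refl) (auto simp: h_diag)
  also have "\<dots> = 1 + (\<Sum>j\<in>UNIV. hit_sum T j i) / \<sigma>"
    by (simp add: sum.distrib sum_divide_distrib)
  also have "(\<Sum>j\<in>UNIV. hit_sum T j i) = in_forest_weight T (int CARD('n) - 2)"
    using in_forest_weight_eq[of T 2] by (simp add: sum_hit_sum_targets)
  also have "\<sigma> = in_forest_weight T (int CARD('n) - 1)"
  proof -
    have "in_forest_weight T (int CARD('n) - 1) = (\<Sum>S | card S = 1. \<Sum>f\<in>forest_maps S. map_weight T S f)"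
      using in_forest_weight_eq[of T 1] by simp
    also have "{S. card S = 1} = range (\<lambda>j :: 'n. {j})"
      by (auto simp: card_1_singleton_iff)
    also have "(\<Sum>S\<in>\<dots>. \<Sum>f\<in>forest_maps S. map_weight T S f) = \<sigma>"
      by (subst sum.reindex) (auto simp: \<sigma>_def tree_sum_def inj_on_def)
    finally show ?thesis ..
  qed
  finally show "kemeny_constant M X \<pi> i =
    ennreal (1 + in_forest_weight T (int CARD('n) - 2) / in_forest_weight T (int CARD('n) - 1))" .
qed

end
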